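(* For every integer $n\geq 3$, the extension complexity of any convex $n$-gon (in $\mathbb{R}^2$) does not exceed $\left\lceil\frac{6n}{7}\right\rceil$.
   Context: An extension of a polytope $P\subset\mathbb{R}^k$ is a polytope $Q\subset\mathbb{R}^d$ such that $P$ is the image of $Q$ under a linear map $\mathbb{R}^d\to\mathbb{R}^k$. An extended formulation of $P$ is a description of such a $Q$ by linear equations and inequalities (together with the projection); its size is the number of facets of $Q$. The extension complexity of $P$ is the smallest size of an extended formulation of $P$, i.e. the minimal number of facets of an extension of $P$. *)

theory Defs
  imports "HOL-Analysis.Analysis" "HOL-Analysis.Finite_Function_Topology" "HOL-Library.Extended_Nat"
begin

text \<open>
  The dimension of an extension is existentially quantified, so it cannot be a type.
  Every space \<open>\<real>\<^sup>d\<close> is realised as the coordinate subspace spanned by the first \<open>d\<close> unit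
  vectors of the library's real vector space of finitely supported sequences.
\<close>

definition coord_space :: "nat \<Rightarrow> (nat \<Rightarrow>\<^sub>0 real) set" where
  "coord_space d = {x. Poly_Mapping.keys x \<subseteq> {..<d}}"

text \<open>
  The library's \<open>facet_of\<close> is restricted to type class \<open>euclidean_space\<close>, because \<open>aff_dim\<close> is.
  Here the dimension of a nonempty convex set is the linear dimension of the space of its
  differences; lemma \<open>is_facet_iff_facet_of\<close> shows that the two notions agree where both make sense.
\<close>

definition diff_dim :: "'a::real_vector set \<Rightarrow> nat" where
  "diff_dim S = dim {x - y | x y. x \<in> S \<and> y \<in> S}"

definition is_facet :: "'a::real_vector set \<Rightarrow> 'a set \<Rightarrow> bool" where
  "is_facet F S \<longleftrightarrow> F face_of S \<and> F \<noteq> {} \<and> diff_dim F + 1 = diff_dim S"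

text \<open>
  A linear map on the whole sequence space restricts to a linear map on \<open>\<real>\<^sup>d\<close>, and every linear
  map on \<open>\<real>\<^sup>d\<close> arises in this way.
\<close>

definition is_extension :: "nat \<Rightarrow> (nat \<Rightarrow>\<^sub>0 real) set \<Rightarrow> 'a::real_vector set \<Rightarrow> bool" where
  "is_extension d Q P \<longleftrightarrow>
     polytope Q \<and> Q \<subseteq> coord_space d \<and> (\<exists>f. linear f \<and> f ` Q = P)"

text \<open>
  The infimum is taken in \<open>enat\<close>, so it would be \<open>\<infinity>\<close>, not \<open>0\<close>, if there were no extension.
\<close>

definition extension_complexity :: "'a::real_vector set \<Rightarrow> enat" where
  "extension_complexity P = (INF (d, Q) \<in> {(d, Q). is_extension d Q P}. enat (card {F. is_facet F Q}))"

text \<open>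
  Having at least three extreme points, a convex \<open>n\<close>-gon is automatically two-dimensional.
\<close>

definition convex_ngon :: "nat \<Rightarrow> (real ^ 2) set \<Rightarrow> bool" where
  "convex_ngon n P \<longleftrightarrow> n \<ge> 3 \<and> polytope P \<and> card {v. v extreme_point_of P} = n"

lemma diff_dim_translate:
  fixes S :: "'a::real_vector set"
  assumes "a \<in> S"
  shows "diff_dim S = dim ((\<lambda>x. x - a) ` S)"
proof -
  have "{x - y | x y. x \<in> S \<and> y \<in> S} \<subseteq> span ((\<lambda>x. x - a) ` S)"
  proof clarify
    fix x y assume "x \<in> S" "y \<in> S"
    then have "(x - a) - (y - a) \<in> span ((\<lambda>x. x - a) ` S)"
      by (intro span_diff span_base) auto
    then show "x - y \<in> span ((\<lambda>x. x - a) ` S)" by simp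
  qed
  moreover have "(\<lambda>x. x - a) ` S \<subseteq> span {x - y | x y. x \<in> S \<and> y \<in> S}"
    using assms by (auto intro!: span_base)
  ultimately have "span {x - y | x y. x \<in> S \<and> y \<in> S} = span ((\<lambda>x. x - a) ` S)"
    by (meson span_eq)
  then show ?thesis
    unfolding diff_dim_def by (rule real_vector.span_eq_dim)
qed

lemma aff_dim_eq_diff_dim:
  fixes S :: "'a::euclidean_space set"
  assumes "S \<noteq> {}"
  shows "aff_dim S = int (diff_dim S)"
proof -
  obtain a where "a \<in> S" using assms by blast
  then show ?thesis
    using aff_dim_eq_dim_subtract[of a S] diff_dim_translate[of a S] by (simp add: hull_inc)
qed

lemma is_facet_iff_facet_of:
  fixes S :: "'a::euclidean_space set"
  shows "is_facet F S \<longleftrightarrow> F facet_of S"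
proof (cases "S = {}")
  case True
  then show ?thesis by (auto simp: is_facet_def facet_of_def face_of_imp_subset)
next
  case False
  have "aff_dim F = aff_dim S - 1 \<longleftrightarrow> diff_dim F + 1 = diff_dim S" if "F \<noteq> {}"
    using aff_dim_eq_diff_dim[OF False] aff_dim_eq_diff_dim[OF that] by linarith
  then show ?thesis
    by (auto simp: is_facet_def facet_of_def)
qed

lemma diff_dim_linear_image:
  fixes f :: "'a::real_vector \<Rightarrow> 'b::real_vector"
  assumes "linear f" "inj f"
  shows "diff_dim (f ` S) = diff_dim S"
proof -
  have "{x - y | x y. x \<in> f ` S \<and> y \<in> f ` S} = f ` {x - y | x y. x \<in> S \<and> y \<in> S}"
  proof (intro equalityI subsetI)
    fix z assume "z \<in> {x - y | x y. x \<in> f ` S \<and> y \<in> f ` S}"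
    then obtain x y where "x \<in> S" "y \<in> S" "z = f x - f y" by blast
    then show "z \<in> f ` {x - y | x y. x \<in> S \<and> y \<in> S}"
      using linear_diff[OF assms(1), of x y] by (intro image_eqI[of _ _ "x - y"]) auto
  next
    fix z assume "z \<in> f ` {x - y | x y. x \<in> S \<and> y \<in> S}"
    then obtain x y where "x \<in> S" "y \<in> S" "z = f (x - y)" by blast
    then show "z \<in> {x - y | x y. x \<in> f ` S \<and> y \<in> f ` S}"
      using linear_diff[OF assms(1), of x y] by auto
  qed
  moreover have "dim (f ` T) = dim T" for T
  proof -
    obtain B where B: "B \<subseteq> T" "independent B" "T \<subseteq> span B" "card B = dim T"
      by (rule real_vector.basis_exists)
    have "independent (f ` B)"
      using linear_independent_injective_image[OF assms(1) B(2)] assms(2)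
      by (meson inj_on_subset subset_UNIV)
    moreover have "f ` B \<subseteq> f ` T" using B(1) by blast
    moreover have "f ` T \<subseteq> span (f ` B)"
      using B(3) linear_span_image[OF assms(1), of B] by (metis image_mono)
    moreover have "card (f ` B) = card B"
      using assms(2) by (metis card_image inj_on_subset[OF _ subset_UNIV])
    ultimately show ?thesis
      using B(4) real_vector.basis_card_eq_dim[of "f ` B" "f ` T"] by linarith
  qed
  ultimately show ?thesis by (simp add: diff_dim_def)
qed

lemma is_facet_linear_image:
  fixes f :: "'a::real_vector \<Rightarrow> 'b::real_vector"
  assumes "linear f" "inj f"
  shows "{F. is_facet F (f ` S)} = image f ` {F. is_facet F S}"
proof -
  have "is_facet (f ` F) (f ` S) \<longleftrightarrow> is_facet F S" for F
    using assms by (simp add: is_facet_def face_of_linear_image diff_dim_linear_image)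
  moreover have "\<exists>G. F = f ` G" if "is_facet F (f ` S)" for F
    using that by (meson face_of_imp_subset is_facet_def subset_imageE)
  ultimately show ?thesis by blast
qed

lemma face_of_finite_convex_hull:
  fixes V :: "'a::real_vector set"
  assumes V: "finite V" and F: "F face_of convex hull V"
  shows "F = convex hull (V \<inter> F)"
proof
  have "convex F" "F \<subseteq> convex hull V"
    using F by (auto simp: face_of_def)
  then show "convex hull (V \<inter> F) \<subseteq> F"
    by (simp add: hull_minimal)
  show "F \<subseteq> convex hull (V \<inter> F)"
  proof
    fix x assume x: "x \<in> F"
    with \<open>F \<subseteq> convex hull V\<close> obtain u
      where u: "\<And>v. v \<in> V \<Longrightarrow> 0 \<le> u v" "sum u V = 1" "(\<Sum>v\<in>V. u v *\<^sub>R v) = x"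
      unfolding convex_hull_finite[OF V] by blast
    have in_F: "v \<in> F" if v: "v \<in> V" "u v \<noteq> 0" for v
    proof (cases "u v = 1")
      case True
      have "sum u (V - {v}) = 0"
        using u(2) True V v(1) by (simp add: sum_diff1)
      then have "u w = 0" if "w \<in> V - {v}" for w
        using sum_nonneg_eq_0_iff[of "V - {v}" u] V u(1) that by auto
      then have "(\<Sum>w\<in>V - {v}. u w *\<^sub>R w) = 0"
        by (intro sum.neutral) auto
      then show ?thesis
        using sum.remove[OF V v(1), of "\<lambda>v. u v *\<^sub>R v"] u(3) True x by simp
    next
      case False
      define w where "w = (\<Sum>z\<in>V - {v}. (u z / (1 - u v)) *\<^sub>R z)"
      have rest: "sum u (V - {v}) = 1 - u v"
        using u(2) V v(1) by (simp add: sum_diff1)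
      have "0 \<le> sum u (V - {v})"
        using u(1) by (intro sum_nonneg) auto
      with rest False have lt: "u v < 1" by linarith
      have "w \<in> convex hull V"
        unfolding w_def
      proof (rule convex_sum)
        show "(\<Sum>z\<in>V - {v}. u z / (1 - u v)) = 1"
          using rest lt by (simp flip: sum_divide_distrib)
      qed (use V u(1) lt in \<open>auto simp: hull_inc\<close>)
      have "(1 - u v) *\<^sub>R w = (\<Sum>z\<in>V - {v}. u z *\<^sub>R z)"
        using lt by (simp add: w_def scaleR_sum_right)
      then have eq: "x = (1 - u v) *\<^sub>R w + u v *\<^sub>R v"
        using sum.remove[OF V v(1), of "\<lambda>v. u v *\<^sub>R v"] u(3) by simp
      show ?thesis
      proof (cases "w = v")
        case True
        then have "x = v"
          using eq by (simp flip: scaleR_add_left)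
        then show ?thesis using x by simp
      next
        case False
        have "0 < u v" using u(1)[OF v(1)] v(2) by simp
        with False eq lt have "x \<in> open_segment w v"
          unfolding in_segment by blast
        then show ?thesis
          using F x \<open>w \<in> convex hull V\<close> hull_inc[OF v(1)] unfolding face_of_def by blast
      qed
    qed
    have "sum u (V \<inter> F) = sum u V" "(\<Sum>v\<in>V \<inter> F. u v *\<^sub>R v) = (\<Sum>v\<in>V. u v *\<^sub>R v)"
      using V in_F by (auto intro!: sum.mono_neutral_left)
    then show "x \<in> convex hull (V \<inter> F)"
      using u V unfolding convex_hull_finite[OF finite_Int[OF disjI1[OF V]]]
      by (auto intro!: exI[of _ u])
  qed
qed

text \<open>
  Hence \<open>card\<close> in the definition of \<open>extension_complexity\<close> is never applied to an infinite set.
\<close>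

lemma finite_facets:
  fixes Q :: "'a::real_vector set"
  assumes "polytope Q"
  shows "finite {F. is_facet F Q}"
proof -
  obtain V where V: "finite V" "Q = convex hull V"
    using assms by (auto simp: polytope_def)
  have "{F. is_facet F Q} \<subseteq> (\<lambda>W. convex hull W) ` Pow V"
    using face_of_finite_convex_hull[OF V(1)] V(2) unfolding is_facet_def by blast
  then show ?thesis
    using V(1) by (meson finite_Pow_iff finite_imageI finite_subset)
qed

lemma lookup_scaleR_poly_mapping:
  "Poly_Mapping.lookup (r *\<^sub>R x) i = r *\<^sub>R Poly_Mapping.lookup x i"
  for x :: "'a \<Rightarrow>\<^sub>0 'b::real_vector"
proof -
  have "finite {i. r *\<^sub>R Poly_Mapping.lookup x i \<noteq> 0}"
    by (rule finite_subset[OF _ finite_lookup[of x]]) auto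
  then show ?thesis
    by (simp add: scaleR_poly_mapping_def Abs_poly_mapping_inverse)
qed

lemma euclidean_embeds_coord_space:
  obtains e :: "'a::euclidean_space \<Rightarrow> (nat \<Rightarrow>\<^sub>0 real)"
    and g :: "(nat \<Rightarrow>\<^sub>0 real) \<Rightarrow> 'a"
  where "linear e" "linear g" "\<And>x. g (e x) = x" "range e \<subseteq> coord_space DIM('a)"
proof -
  obtain b where b: "bij_betw b {..<DIM('a)} (Basis :: 'a set)"
    using ex_bij_betw_nat_finite[OF finite_Basis] by (auto simp: atLeast0LessThan)
  define e :: "'a \<Rightarrow> (nat \<Rightarrow>\<^sub>0 real)"
    where "e x = (\<Sum>i<DIM('a). Poly_Mapping.single i (x \<bullet> b i))" for x
  define g :: "(nat \<Rightarrow>\<^sub>0 real) \<Rightarrow> 'a"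
    where "g y = (\<Sum>i<DIM('a). Poly_Mapping.lookup y i *\<^sub>R b i)" for y
  have lookup_e: "Poly_Mapping.lookup (e x) i = (if i < DIM('a) then x \<bullet> b i else 0)" for x i
    by (simp add: e_def lookup_sum lookup_single when_def)
  have "linear e"
    by (rule linearI; rule poly_mapping_eqI)
       (auto simp: lookup_e lookup_add lookup_scaleR_poly_mapping inner_add_left)
  moreover have "linear g"
    by (rule linearI)
       (auto simp: g_def lookup_add lookup_scaleR_poly_mapping scaleR_add_left sum.distrib
         scaleR_sum_right)
  moreover have "g (e x) = x" for x
  proof -
    have "g (e x) = (\<Sum>i<DIM('a). (x \<bullet> b i) *\<^sub>R b i)"
      by (simp add: g_def lookup_e)
    also have "\<dots> = (\<Sum>v\<in>Basis. (x \<bullet> v) *\<^sub>R v)"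
      by (rule sum.reindex_bij_betw[OF b])
    finally show ?thesis by (simp add: euclidean_representation)
  qed
  moreover have "range e \<subseteq> coord_space DIM('a)"
    by (auto simp: coord_space_def in_keys_iff lookup_e split: if_splits)
  ultimately show ?thesis by (rule that)
qed

lemma extension_complexity_le:
  fixes Q :: "'b::euclidean_space set" and P :: "'a::real_vector set"
  assumes "polytope Q" "linear f" "f ` Q = P"
  shows "extension_complexity P \<le> enat (card {F. F facet_of Q})"
proof -
  obtain e :: "'b \<Rightarrow> (nat \<Rightarrow>\<^sub>0 real)" and g
    where e: "linear e" "linear g" "\<And>x. g (e x) = x" "range e \<subseteq> coord_space DIM('b)"
    by (rule euclidean_embeds_coord_space) blast
  have inj: "inj e"
    by (metis e(3) injI)
  have "polytope (e ` Q)"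
  proof -
    obtain V where "finite V" "Q = convex hull V"
      using assms(1) by (auto simp: polytope_def)
    then show ?thesis
      unfolding polytope_def using e(1) by (metis convex_hull_linear_image finite_imageI)
  qed
  moreover have "linear (f \<circ> g)"
    using assms(2) e(2) by (simp add: linear_compose)
  moreover have "(f \<circ> g) ` (e ` Q) = P"
    using e(3) assms(3) by (simp add: image_image)
  ultimately have "is_extension DIM('b) (e ` Q) P"
    unfolding is_extension_def using e(4) by blast
  then have "extension_complexity P \<le> enat (card {F. is_facet F (e ` Q)})"
    unfolding extension_complexity_def
    by (intro INF_lower2[of "(DIM('b), e ` Q)"]) auto
  also have "card {F. is_facet F (e ` Q)} = card {F. F facet_of Q}"
    unfolding is_facet_linear_image[OF e(1) inj] is_facet_iff_facet_of
    using inj by (intro card_image) (meson inj_image_eq_iff inj_onI)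
  finally show ?thesis .
qed

end

theory Submission
  imports Defs
begin

text \<open>
  Homogenise: a convex \<open>m\<close>-gon is a slice of the cone spanned by vectors \<open>p 0\<close>, ..., \<open>p (m - 1)\<close>
  of \<open>\<real>\<^sup>3\<close>. If cones are linear images of polyhedral cones with \<open>k\<close> and \<open>l\<close> facets, then their
  sum is an image of the product, which has \<open>k + l\<close> facets. A ray costs one facet, so it is enough
  to represent the cone over a heptagon with six: the vertices are then split into groups of seven
  and at most six single points.

  The cone over a product of two triangles has six facets, and its image is spanned by the nine
  sums \<open>a s + b t\<close> of vectors \<open>a 0, a 1, a 2\<close> and \<open>b 0, b 1, b 2\<close>. One can choose them such that
  seven of the sums are positive multiples of \<open>p 0\<close>, ..., \<open>p 6\<close>. The other two lie in the cone if
  two inequalities between \<open>3 \<times> 3\<close> minors hold; these depend on where the cyclic labelling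
  of the heptagon starts, and Pluecker relations show that they cannot fail for all seven
  starting points.
\<close>

subsection \<open>Facets and inequalities\<close>

text \<open>\<open>\<phi>\<close> vanishes on \<open>span T\<close>, so \<open>x\<close> extends a
  basis of \<open>T\<close> to an independent subset of \<open>span S\<close>. The finite
  \<open>B\<close> matters because \<open>dim\<close> is a \<open>card\<close>, hence 0 for infinite
  bases.\<close>

lemma dim_less_of_functional:
  fixes S T :: "'a::real_vector set" and \<phi> :: "'a \<Rightarrow> real"
  assumes "T \<subseteq> S" "finite B" "S \<subseteq> span B"
    and "linear \<phi>" "\<And>x. x \<in> T \<Longrightarrow> \<phi> x = 0" "x \<in> S" "\<phi> x \<noteq> 0"
  shows "dim T < dim S"
proof -
  obtain BT where BT: "BT \<subseteq> T" "independent BT" "T \<subseteq> span BT" "card BT = dim T"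
    by (rule real_vector.basis_exists)
  obtain BS where BS: "BS \<subseteq> S" "independent BS" "S \<subseteq> span BS" "card BS = dim S"
    by (rule real_vector.basis_exists)
  have fin: "finite BS"
    using BS(1,2) assms(2,3) independent_span_bound[of B BS] by blast
  have "\<phi> y = 0" if "y \<in> span BT" for y
    using that BT(1) assms(5) linear_eq_0_on_span[OF assms(4), of BT y] by blast
  with assms(7) have x: "x \<notin> span BT" by blast
  have "independent (insert x BT)"
    using x BT(2) by (simp add: independent_insertI)
  moreover have "insert x BT \<subseteq> span BS"
    using subset_trans[OF BT(1) subset_trans[OF assms(1) BS(3)]] subsetD[OF BS(3) assms(6)]
    by (rule insert_subsetI[rotated])
  ultimately have "finite (insert x BT) \<and> card (insert x BT) \<le> card BS"
    by (rule independent_span_bound[OF fin])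
  moreover have "x \<notin> BT" using x span_base by blast
  ultimately show ?thesis
    using BT(4) BS(4) by auto
qed

lemma diff_dim_less_of_functional:
  fixes F G :: "'a::real_vector set" and \<phi> :: "'a \<Rightarrow> real"
  assumes "F \<subseteq> G" "F \<noteq> {}" "finite B" "G \<subseteq> span B"
    and "linear \<phi>" "\<And>x. x \<in> F \<Longrightarrow> \<phi> x = 0" "x \<in> G" "\<phi> x \<noteq> 0"
  shows "diff_dim F < diff_dim G"
proof -
  obtain f where f: "f \<in> F" using assms(2) by blast
  have in_diff: "x - f \<in> {x - y | x y. x \<in> G \<and> y \<in> G}" and ne: "\<phi> (x - f) \<noteq> 0"
    using assms(1,6,7,8) f linear_diff[OF assms(5), of x f] by auto
  have sub: "{x - y | x y. x \<in> F \<and> y \<in> F} \<subseteq> {x - y | x y. x \<in> G \<and> y \<in> G}"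
    using assms(1) by blast
  have span: "{x - y | x y. x \<in> G \<and> y \<in> G} \<subseteq> span B"
    using assms(4) by (auto intro!: span_diff)
  have zero: "\<phi> z = 0" if "z \<in> {x - y | x y. x \<in> F \<and> y \<in> F}" for z
    using that assms(6) linear_diff[OF assms(5)] by auto
  show ?thesis
    unfolding diff_dim_def
    by (rule dim_less_of_functional[OF sub assms(3) span assms(5) zero in_diff ne])
qed

text \<open>A point \<open>x\<close> of \<open>F\<close> with as many strict inequalities as
  possible serves as a relative interior point: what is tight at \<open>x\<close> is tight on all of
  \<open>F\<close>. If these inequalities vanished on all of \<open>Q\<close>, every segment from a
  point of \<open>Q\<close> to \<open>x\<close> could be prolonged inside \<open>Q\<close>, which
  forces \<open>F = Q\<close>.\<close>

lemma proper_face_tight_inequality: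
  fixes Q :: "'a::real_vector set" and \<phi> :: "'i \<Rightarrow> 'a \<Rightarrow> real"
  assumes Q: "Q = {x \<in> M. \<forall>i\<in>I. 0 \<le> \<phi> i x}" and "affine M" "finite I"
    and lin: "\<And>i. i \<in> I \<Longrightarrow> linear (\<phi> i)"
    and F: "F face_of Q" "F \<noteq> {}" "F \<noteq> Q"
  obtains i where "i \<in> I" "\<And>x. x \<in> F \<Longrightarrow> \<phi> i x = 0" "\<exists>x\<in>Q. \<phi> i x \<noteq> 0"
proof -
  have FQ: "F \<subseteq> Q" and cF: "convex F"
    using F(1) by (auto simp: face_of_def)
  define c where "c x = card {i \<in> I. 0 < \<phi> i x}" for x
  have "c x \<le> card I" for x
    unfolding c_def using assms(3) by (intro card_mono) auto
  then have bd: "\<forall>y. y \<in> F \<longrightarrow> c y < Suc (card I)" by (simp add: less_Suc_eq_le)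
  obtain y where "y \<in> F" using F(2) by blast
  from ex_has_greatest_nat[of "\<lambda>x. x \<in> F", OF this bd]
  obtain x where x: "x \<in> F" "\<And>y. y \<in> F \<Longrightarrow> c y \<le> c x"
    by auto
  have zero: "\<phi> i y = 0" if i: "i \<in> I" "\<phi> i x = 0" and y: "y \<in> F" for i y
  proof (rule ccontr)
    assume ne: "\<phi> i y \<noteq> 0"
    \<comment> \<open>The midpoint is slack wherever \<open>x\<close> or \<open>y\<close> is, so it
      would beat the maximal \<open>x\<close>.\<close>
    define z where "z = (1/2) *\<^sub>R x + (1/2) *\<^sub>R y"
    have z: "z \<in> F" unfolding z_def using cF x(1) y by (intro convexD) auto
    have \<phi>z: "\<phi> j z = \<phi> j x / 2 + \<phi> j y / 2" if "j \<in> I" for j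
      using lin[OF that] by (simp add: z_def linear_add linear_scale)
    have nn: "0 \<le> \<phi> j x" "0 \<le> \<phi> j y" if "j \<in> I" for j
      using that x(1) y FQ Q by auto
    have pos: "0 < \<phi> j z" if "j \<in> I" "0 < \<phi> j x" for j
      using \<phi>z[OF that(1)] nn(2)[OF that(1)] that(2) by linarith
    have "{j \<in> I. 0 < \<phi> j x} \<subset> {j \<in> I. 0 < \<phi> j z}"
    proof
      show "{j \<in> I. 0 < \<phi> j x} \<subseteq> {j \<in> I. 0 < \<phi> j z}"
        using pos by blast
      show "{j \<in> I. 0 < \<phi> j x} \<noteq> {j \<in> I. 0 < \<phi> j z}"
      proof -
        have "0 < \<phi> i z" using \<phi>z[OF i(1)] nn(2)[OF i(1)] i(2) ne by linarith
        then have "i \<in> {j \<in> I. 0 < \<phi> j z}" "i \<notin> {j \<in> I. 0 < \<phi> j x}"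
          using i by auto
        then show ?thesis by blast
      qed
    qed
    then have "c x < c z"
      unfolding c_def using assms(3) by (intro psubset_card_mono) auto
    then show False using x(2)[OF z] by simp
  qed
  have "\<exists>i\<in>I. \<phi> i x = 0 \<and> (\<exists>q\<in>Q. \<phi> i q \<noteq> 0)"
  proof (rule ccontr)
    assume "\<not> ?thesis"
    then have van: "\<phi> i q = 0" if "i \<in> I" "\<phi> i x = 0" "q \<in> Q" for i q
      using that by blast
    have "q \<in> F" if q: "q \<in> Q" for q
    proof (cases "q = x")
      case True then show ?thesis using x(1) by simp
    next
      case False
      \<comment> \<open>Moving from \<open>x\<close> away from \<open>q\<close>: constraints tight
        at \<open>x\<close> stay 0 by \<open>van\<close>, slack ones survive small steps.\<close>
      have "eventually (\<lambda>e. 0 \<le> \<phi> i (x + e *\<^sub>R (x - q))) (at_right 0)" if i: "i \<in> I" for i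
      proof (cases "\<phi> i x = 0")
        case True
        then show ?thesis
          using van[OF i True q] lin[OF i] by (simp add: linear_add linear_scale linear_diff)
      next
        case False
        then have "0 < \<phi> i x" using x(1) FQ Q i by force
        moreover have "((\<lambda>e. \<phi> i x + e * (\<phi> i x - \<phi> i q)) \<longlongrightarrow> \<phi> i x + 0 * (\<phi> i x - \<phi> i q))
            (at_right 0)"
          by (intro tendsto_intros)
        ultimately have "eventually (\<lambda>e. 0 < \<phi> i x + e * (\<phi> i x - \<phi> i q)) (at_right 0)"
          by (intro order_tendstoD(1)) auto
        then show ?thesis
          by (rule eventually_mono)
             (use lin[OF i] in \<open>auto simp: linear_add linear_scale linear_diff\<close>)
      qed
      then have "eventually (\<lambda>e. \<forall>i\<in>I. 0 \<le> \<phi> i (x + e *\<^sub>R (x - q))) (at_right 0)"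
        using assms(3) by (simp add: eventually_ball_finite)
      moreover have "eventually (\<lambda>e::real. 0 < e) (at_right 0)"
        by (simp add: eventually_at_right_less)
      ultimately have "eventually (\<lambda>e. (\<forall>i\<in>I. 0 \<le> \<phi> i (x + e *\<^sub>R (x - q))) \<and> 0 < e)
          (at_right 0)"
        by (rule eventually_conj)
      from eventually_happens'[OF _ this] obtain e
        where e: "e > 0" "\<And>i. i \<in> I \<Longrightarrow> 0 \<le> \<phi> i (x + e *\<^sub>R (x - q))"
        by auto
      define y where "y = x + e *\<^sub>R (x - q)"
      have "x \<in> M" "q \<in> M" using x(1) FQ q Q by auto
      then have "(1 + e) *\<^sub>R x + (- e) *\<^sub>R q \<in> M"
        using assms(2) by (intro mem_affine) auto
      then have "y \<in> M" by (simp add: y_def algebra_simps)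
      then have yQ: "y \<in> Q" using e(2) Q by (auto simp: y_def)
      have "1 / (1 + e) * (1 + e) = 1" using e(1) by simp
      moreover have "(1 - t) *\<^sub>R q + t *\<^sub>R y = (1 - t * (1 + e)) *\<^sub>R q + (t * (1 + e)) *\<^sub>R x" for t
        by (simp add: y_def algebra_simps)
      ultimately have "x = (1 - 1 / (1 + e)) *\<^sub>R q + (1 / (1 + e)) *\<^sub>R y"
        by simp
      moreover have "q \<noteq> y"
      proof
        assume "q = y"
        then have "(1 + e) *\<^sub>R (x - q) = 0" by (simp add: y_def algebra_simps)
        then show False using e(1) \<open>q \<noteq> x\<close> by simp
      qed
      ultimately have "x \<in> open_segment q y"
        unfolding in_segment using e(1) by (auto intro!: exI[of _ "1 / (1 + e)"])
      then show ?thesis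
        using F(1) x(1) q yQ unfolding face_of_def by blast
    qed
    then show False using F(3) FQ by blast
  qed
  then show ?thesis using that zero by blast
qed

text \<open>Every facet is cut out by a single inequality, so the facets are among at most
  \<open>card I\<close> sets. A facet \<open>F\<close> lies in some
  \<open>G = Q \<inter> {x. \<phi> i x = 0}\<close> of smaller dimension than \<open>Q\<close>; if
  \<open>F \<noteq> G\<close>, the same argument inside \<open>G\<close> drops the dimension a
  second time, contrary to codimension one.\<close>

lemma card_facets_le:
  fixes Q :: "'a::real_vector set" and \<phi> :: "'i \<Rightarrow> 'a \<Rightarrow> real"
  assumes Q: "Q = {x \<in> M. \<forall>i\<in>I. 0 \<le> \<phi> i x}" and M: "affine M" and I: "finite I"
    and lin: "\<And>i. i \<in> I \<Longrightarrow> linear (\<phi> i)"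
    and B: "finite B" "Q \<subseteq> span B"
  shows "card {F. is_facet F Q} \<le> card I"
proof -
  have "\<exists>i. i \<in> I \<and> F = Q \<inter> {x. \<phi> i x = 0}" if F: "is_facet F Q" for F
  proof -
    have face: "F face_of Q" "F \<noteq> {}" "diff_dim F + 1 = diff_dim Q"
      using F by (auto simp: is_facet_def)
    then have "F \<noteq> Q" by auto
    then obtain i where i: "i \<in> I" "\<And>x. x \<in> F \<Longrightarrow> \<phi> i x = 0" "\<exists>x\<in>Q. \<phi> i x \<noteq> 0"
      using proper_face_tight_inequality[OF Q M I lin face(1,2)] by blast
    define G where "G = Q \<inter> {x. \<phi> i x = 0}"
    have FG: "F \<subseteq> G"
      using face_of_imp_subset[OF face(1)] i(2) by (auto simp: G_def)
    have GQ: "diff_dim G < diff_dim Q"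
    proof -
      obtain q where "q \<in> Q" "\<phi> i q \<noteq> 0" using i(3) by blast
      moreover have "G \<subseteq> Q" "G \<noteq> {}" "\<And>x. x \<in> G \<Longrightarrow> \<phi> i x = 0"
        using FG face(2) by (auto simp: G_def)
      ultimately show ?thesis
        using diff_dim_less_of_functional[OF _ _ B lin[OF i(1)]] by blast
    qed
    have "F = G"
    proof (rule ccontr)
      assume ne: "F \<noteq> G"
      have aff: "affine (M \<inter> {x. \<phi> i x = 0})"
      proof -
        have "affine {x. \<phi> i x = 0}"
          using lin[OF i(1)] by (auto simp: affine_def linear_add linear_scale)
        then show ?thesis using M by (rule affine_Int[rotated])
      qed
      \<comment> \<open>\<open>G\<close> has the same inequalities over a smaller affine set, so
        \<open>proper_face_tight_inequality\<close> applies again.\<close>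
      have G: "G = {x \<in> M \<inter> {x. \<phi> i x = 0}. \<forall>i\<in>I. 0 \<le> \<phi> i x}"
        using Q by (auto simp: G_def)
      have "F face_of G"
        using face(1) FG by (rule face_of_subset) (auto simp: G_def)
      then obtain j where j: "j \<in> I" "\<And>x. x \<in> F \<Longrightarrow> \<phi> j x = 0" "\<exists>x\<in>G. \<phi> j x \<noteq> 0"
        using proper_face_tight_inequality[OF G aff I lin _ face(2) ne] by blast
      then obtain g where "g \<in> G" "\<phi> j g \<noteq> 0" by blast
      moreover have "G \<subseteq> span B" using B(2) by (auto simp: G_def)
      ultimately have "diff_dim F < diff_dim G"
        using diff_dim_less_of_functional[OF FG face(2) B(1) _ lin[OF j(1)]] j(2) by blast
      then show False using GQ face(3) by simp
    qed
    then show ?thesis using i(1) G_def by blast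
  qed
  then have "{F. is_facet F Q} \<subseteq> (\<lambda>i. Q \<inter> {x. \<phi> i x = 0}) ` I"
    by blast
  then show ?thesis
    by (meson I card_image_le card_mono finite_imageI order_trans)
qed

subsection \<open>Sums of polyhedral cones\<close>

text \<open>The number \<open>k\<close> of coordinate inequalities later bounds the number of
  facets. \<open>S\<close> is the image of a finite generating set rather than of the whole cone;
  with \<open>W\<close> carried along, slices are polytopes without a separate proof of finite
  generation.\<close>

definition cone_extension :: "nat \<Rightarrow> 'a::real_vector set \<Rightarrow> bool" where
  "cone_extension k S \<longleftrightarrow> (\<exists>L W g. subspace L \<and> finite W \<and> linear g \<and> g ` W = S \<and>
     {y \<in> coord_space k \<inter> L. \<forall>i. 0 \<le> Poly_Mapping.lookup y i} = convex_cone hull W)"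

lemma linear_lookup: "linear (\<lambda>y::nat \<Rightarrow>\<^sub>0 real. Poly_Mapping.lookup y i)"
  by (rule linearI) (auto simp: lookup_add lookup_scaleR_poly_mapping)

lemma coord_space_iff: "y \<in> coord_space k \<longleftrightarrow> (\<forall>i\<ge>k. Poly_Mapping.lookup y i = 0)"
  by (auto simp: coord_space_def in_keys_iff subset_iff not_le[symmetric])

lemma keys_subset_iff:
  "Poly_Mapping.keys y \<subseteq> A \<longleftrightarrow> (\<forall>i. i \<notin> A \<longrightarrow> Poly_Mapping.lookup y i = 0)"
  by (auto simp: in_keys_iff)

lemma subspace_keys_subset: "subspace {y::nat \<Rightarrow>\<^sub>0 real. Poly_Mapping.keys y \<subseteq> A}"
  by (auto simp: subspace_def keys_subset_iff lookup_add lookup_scaleR_poly_mapping)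

lemma subspace_coord_space: "subspace (coord_space k)"
  by (auto simp: subspace_def coord_space_iff lookup_add lookup_scaleR_poly_mapping)

lemma coord_space_subset_span:
  "coord_space k \<subseteq> span ((\<lambda>i. Poly_Mapping.single i (1::real)) ` {..<k})"
proof
  fix y :: "nat \<Rightarrow>\<^sub>0 real"
  assume y: "y \<in> coord_space k"
  have "y = (\<Sum>i<k. Poly_Mapping.lookup y i *\<^sub>R Poly_Mapping.single i 1)"
    using y by (intro poly_mapping_eqI)
      (auto simp: lookup_sum lookup_scaleR_poly_mapping lookup_single when_def coord_space_iff
        if_distrib cong: if_cong)
  also have "\<dots> \<in> span ((\<lambda>i. Poly_Mapping.single i 1) ` {..<k})"
    by (intro span_sum span_scale span_base) auto
  finally show "y \<in> span ((\<lambda>i. Poly_Mapping.single i 1) ` {..<k})" .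
qed

definition coord_proj :: "nat set \<Rightarrow> (nat \<Rightarrow>\<^sub>0 real) \<Rightarrow> (nat \<Rightarrow>\<^sub>0 real)" where
  "coord_proj A y = (\<Sum>i\<in>A. Poly_Mapping.single i (Poly_Mapping.lookup y i))"

lemma lookup_coord_proj:
  "finite A \<Longrightarrow> Poly_Mapping.lookup (coord_proj A y) i = (if i \<in> A then Poly_Mapping.lookup y i else 0)"
  by (simp add: coord_proj_def lookup_sum lookup_single when_def)

lemma linear_coord_proj: "finite A \<Longrightarrow> linear (coord_proj A)"
  by (rule linearI; rule poly_mapping_eqI)
     (auto simp: lookup_coord_proj lookup_add lookup_scaleR_poly_mapping)

lemma convex_cone_nonneg_coords:
  assumes "subspace (L :: (nat \<Rightarrow>\<^sub>0 real) set)"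
  shows "convex_cone {y \<in> L. \<forall>i. 0 \<le> Poly_Mapping.lookup y i}"
proof -
  have "0 \<in> {y \<in> L. \<forall>i. 0 \<le> Poly_Mapping.lookup y i}"
    using assms by (simp add: subspace_0)
  then show ?thesis
    using assms unfolding convex_cone_iff
    by (auto simp: subspace_add subspace_scale lookup_add lookup_scaleR_poly_mapping)
qed

lemma cone_extension_empty: "cone_extension 0 {}"
proof -
  have "{y \<in> coord_space 0 \<inter> UNIV. \<forall>i. 0 \<le> Poly_Mapping.lookup y i} = {0 :: nat \<Rightarrow>\<^sub>0 real}"
    by (auto simp: coord_space_iff intro: poly_mapping_eqI)
  then show ?thesis
    unfolding cone_extension_def
    by (intro exI[of _ UNIV] exI[of _ "{}"] exI[of _ "\<lambda>_. 0"]) (auto simp: linear_zero)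
qed

text \<open>This is the direct product of two cones, the second placed in the fresh coordinates
  \<open>k\<close>, ..., \<open>k + d - 1\<close>. It is generated by the union of the two
  generating sets, and the inequality counts add.\<close>

lemma cone_extension_Un:
  fixes S :: "'a::real_vector set" and M :: "(nat \<Rightarrow>\<^sub>0 real) set"
  assumes "cone_extension k S" and M: "subspace M" and W0: "finite W0" and g0: "linear g0"
    and eq0: "{y \<in> M. Poly_Mapping.keys y \<subseteq> {k..<k + d} \<and> (\<forall>i. 0 \<le> Poly_Mapping.lookup y i)} =
      convex_cone hull W0"
  shows "cone_extension (k + d) (S \<union> g0 ` W0)"
proof -
  obtain L W g where L: "subspace L" and W: "finite W" and g: "linear g" and S: "g ` W = S"
    and eq: "{y \<in> coord_space k \<inter> L. \<forall>i. 0 \<le> Poly_Mapping.lookup y i} = convex_cone hull W"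
    using assms(1) unfolding cone_extension_def by blast
  define p where "p = coord_proj {..<k}"
  define q where "q = coord_proj {k..<k + d}"
  have lin: "linear p" "linear q"
    by (simp_all add: p_def q_def linear_coord_proj)
  have pW: "p w = w" "q w = 0" if "w \<in> coord_space k" for w
    using that by (auto simp: p_def q_def lookup_coord_proj coord_space_iff intro!: poly_mapping_eqI)
  have qW: "p w = 0" "q w = w" if "Poly_Mapping.keys w \<subseteq> {k..<k + d}" for w
    using that by (auto simp: p_def q_def lookup_coord_proj keys_subset_iff intro!: poly_mapping_eqI)
  have W_hull: "W \<subseteq> {y \<in> coord_space k \<inter> L. \<forall>i. 0 \<le> Poly_Mapping.lookup y i}"
    unfolding eq by (rule hull_subset)
  have W0_hull: "W0 \<subseteq> {y \<in> M. Poly_Mapping.keys y \<subseteq> {k..<k + d} \<and>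
      (\<forall>i. 0 \<le> Poly_Mapping.lookup y i)}"
    unfolding eq0 by (rule hull_subset)
  \<comment> \<open>\<open>N\<close> imposes \<open>L\<close> on the first block of coordinates and
    \<open>M\<close> on the second.\<close>
  define N where "N = {y. p y \<in> L} \<inter> {y. q y \<in> M}"
  have N: "subspace N"
    unfolding N_def
    using linear_subspace_vimage[OF lin(1) L] linear_subspace_vimage[OF lin(2) M]
    by (auto simp: vimage_def intro: subspace_inter)
  have "{y \<in> coord_space (k + d) \<inter> N. \<forall>i. 0 \<le> Poly_Mapping.lookup y i} = convex_cone hull (W \<union> W0)"
    (is "?K = _")
  proof
    show "convex_cone hull (W \<union> W0) \<subseteq> ?K"
    proof (rule hull_minimal)
      show "convex_cone ?K"
        by (intro convex_cone_nonneg_coords subspace_inter subspace_coord_space N)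
      show "W \<union> W0 \<subseteq> ?K"
      proof
        fix w assume "w \<in> W \<union> W0"
        then show "w \<in> ?K"
        proof
          assume "w \<in> W"
          then show ?thesis
            using W_hull pW[of w] M by (auto simp: N_def coord_space_iff subspace_0)
        next
          assume "w \<in> W0"
          then have "w \<in> M" "Poly_Mapping.keys w \<subseteq> {k..<k + d}" "\<forall>i. 0 \<le> Poly_Mapping.lookup w i"
            using W0_hull by auto
          then show ?thesis
            using qW[of w] L by (auto simp: N_def coord_space_def subspace_0)
        qed
      qed
    qed
    show "?K \<subseteq> convex_cone hull (W \<union> W0)"
    proof
      fix y assume y: "y \<in> ?K"
      have "p y \<in> convex_cone hull W"
        using y unfolding eq[symmetric] by (auto simp: N_def p_def lookup_coord_proj coord_space_iff)
      moreover have "q y \<in> convex_cone hull W0"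
        using y unfolding eq0[symmetric]
        by (auto simp: N_def q_def lookup_coord_proj in_keys_iff split: if_splits)
      ultimately have "p y + q y \<in> convex_cone hull (W \<union> W0)"
        by (meson convex_cone_hull_add hull_mono subsetD sup_ge1 sup_ge2)
      moreover have "p y + q y = y"
        using y by (intro poly_mapping_eqI)
          (auto simp: p_def q_def lookup_add lookup_coord_proj coord_space_iff)
      ultimately show "y \<in> convex_cone hull (W \<union> W0)" by simp
    qed
  qed
  moreover have "linear (\<lambda>y. g (p y) + g0 (q y))"
    using lin g g0 by (intro linear_compose_add) (auto simp: linear_compose[unfolded o_def])
  moreover have "(\<lambda>y. g (p y) + g0 (q y)) ` (W \<union> W0) = S \<union> g0 ` W0"
  proof -
    have "(\<lambda>y. g (p y) + g0 (q y)) ` W = g ` W"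
      using W_hull pW linear_0[OF g0] by (intro image_cong) auto
    moreover have "(\<lambda>y. g (p y) + g0 (q y)) ` W0 = g0 ` W0"
      using W0_hull qW linear_0[OF g] by (intro image_cong) auto
    ultimately show ?thesis using S by (simp add: image_Un)
  qed
  ultimately show ?thesis
    unfolding cone_extension_def using N W W0 by blast
qed

text \<open>The case \<open>d = 1\<close> of the product: a half-line generated by one unit
  vector.\<close>

lemma cone_extension_insert:
  assumes "cone_extension k S"
  shows "cone_extension (Suc k) (insert s S)"
proof -
  define e :: "nat \<Rightarrow>\<^sub>0 real" where "e = Poly_Mapping.single k 1"
  have K: "{y \<in> UNIV. Poly_Mapping.keys y \<subseteq> {k..<k + 1} \<and> (\<forall>i. 0 \<le> Poly_Mapping.lookup y i)} =
      convex_cone hull {e}" (is "?K = _")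
  proof
    show "?K \<subseteq> convex_cone hull {e}"
    proof
      fix y assume y: "y \<in> ?K"
      then have "y = Poly_Mapping.lookup y k *\<^sub>R e"
        by (intro poly_mapping_eqI)
          (force simp: e_def lookup_scaleR_poly_mapping lookup_single when_def in_keys_iff)
      moreover have "Poly_Mapping.lookup y k *\<^sub>R e \<in> convex_cone hull {e}"
        using y by (intro convex_cone_hull_mul hull_inc) auto
      ultimately show "y \<in> convex_cone hull {e}" by simp
    qed
    have "convex_cone ?K"
      using convex_cone_nonneg_coords[OF subspace_keys_subset] by simp
    moreover have "e \<in> ?K" by (auto simp: e_def lookup_single when_def)
    ultimately show "convex_cone hull {e} \<subseteq> ?K" by (intro hull_minimal) auto
  qed
  have "linear (\<lambda>y. Poly_Mapping.lookup y k *\<^sub>R s)"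
    using linear_compose[OF linear_lookup linear_scaleR_left[of s]] by (simp add: o_def)
  from cone_extension_Un[OF assms subspace_UNIV _ this K] show ?thesis
    by (simp add: e_def Un_commute)
qed

text \<open>
  The cone over a product of two triangles is cut out of the orthant of \<open>\<real>\<^sup>6\<close> by one equation,
  so these nine generators cost only six inequalities.
\<close>

lemma cone_extension_triangle_product:
  assumes "cone_extension k S"
  shows "cone_extension (k + 6) (S \<union> (\<lambda>(s, t). a s + b t) ` ({..<3::nat} \<times> {..<3::nat}))"
proof -
  define e :: "nat \<Rightarrow> (nat \<Rightarrow>\<^sub>0 real)" where "e s = Poly_Mapping.single (k + s) 1" for s
  define f :: "nat \<Rightarrow> (nat \<Rightarrow>\<^sub>0 real)" where "f s = Poly_Mapping.single (k + 3 + s) 1" for s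
  define x where "x s y = Poly_Mapping.lookup y (k + s)" for s and y :: "nat \<Rightarrow>\<^sub>0 real"
  define z where "z s y = Poly_Mapping.lookup y (k + 3 + s)" for s and y :: "nat \<Rightarrow>\<^sub>0 real"
  \<comment> \<open>The single equation: both coordinate triples have the same sum.\<close>
  define M where "M = {y. (\<Sum>s<3. x s y) = (\<Sum>s<3. z s y)}"
  define W where "W = (\<lambda>(s, t). e s + f t) ` ({..<3} \<times> {..<3})"
  have linx: "linear (x s)" "linear (z s)" for s
    unfolding x_def z_def by (rule linear_lookup)+
  have M: "subspace M"
    using linx by (auto simp: M_def subspace_def linear_0 linear_add linear_scale sum.distrib
        simp flip: sum_distrib_left)
  have xe: "x s (e t) = (if s = t then 1 else 0)" "z s (f t) = (if s = t then 1 else 0)" for s t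
    by (auto simp: x_def z_def e_def f_def lookup_single when_def)
  have xf: "x s (f t) = 0" "z t (e s) = 0" if "s < 3" for s t
    using that by (auto simp: x_def z_def e_def f_def lookup_single when_def)
  have K: "{y \<in> M. Poly_Mapping.keys y \<subseteq> {k..<k + 6} \<and> (\<forall>i. 0 \<le> Poly_Mapping.lookup y i)} =
      convex_cone hull W" (is "?K = _")
  proof
    show "?K \<subseteq> convex_cone hull W"
    proof
      fix y assume y: "y \<in> ?K"
      define T where "T = (\<Sum>s<3. x s y)"
      have Tz: "T = (\<Sum>s<3. z s y)" using y by (simp add: M_def T_def)
      have nn: "0 \<le> x s y" "0 \<le> z s y" for s using y by (auto simp: x_def z_def)
      have T0: "0 \<le> T" unfolding T_def using nn by (intro sum_nonneg) auto
      have yeq: "y = (\<Sum>s<3. x s y *\<^sub>R e s) + (\<Sum>t<3. z t y *\<^sub>R f t)"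
      proof (rule poly_mapping_eqI)
        fix i
        consider "i < k" | "k + 6 \<le> i" | "i = k" | "i = k + 1" | "i = k + 2" | "i = k + 3"
          | "i = k + 4" | "i = k + 5" by linarith
        then show "Poly_Mapping.lookup y i = Poly_Mapping.lookup
            ((\<Sum>s<3. x s y *\<^sub>R e s) + (\<Sum>t<3. z t y *\<^sub>R f t)) i"
          using y by cases (auto simp: eval_nat_numeral e_def f_def x_def z_def lookup_add
              lookup_scaleR_poly_mapping lookup_single when_def in_keys_iff subset_iff)
      qed
      \<comment> \<open>Independent coupling: the weights \<open>x s y * z t y / T\<close> have row
        sums \<open>x s y\<close> and column sums \<open>z t y\<close>. If \<open>T = 0\<close>, all
        coordinates vanish and both sides are 0.\<close>
      have "y = (\<Sum>s<3. \<Sum>t<3. (x s y * z t y / T) *\<^sub>R (e s + f t))"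
      proof (cases "T = 0")
        case True
        then have "x s y = 0" "z s y = 0" if "s < 3" for s
          using that nn Tz T_def sum_nonneg_eq_0_iff[of "{..<3}" "\<lambda>s. x s y"]
            sum_nonneg_eq_0_iff[of "{..<3}" "\<lambda>s. z s y"] by auto
        then show ?thesis using yeq by simp
      next
        case False
        have "(\<Sum>s<3. \<Sum>t<3. (x s y * z t y / T) *\<^sub>R (e s + f t)) =
          (\<Sum>s<3. \<Sum>t<3. (x s y * z t y / T) *\<^sub>R e s) + (\<Sum>s<3. \<Sum>t<3. (x s y * z t y / T) *\<^sub>R f t)"
          by (simp add: scaleR_add_right sum.distrib)
        also have "(\<Sum>s<3. \<Sum>t<3. (x s y * z t y / T) *\<^sub>R e s) = (\<Sum>s<3. x s y *\<^sub>R e s)"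
          using False by (intro sum.cong refl)
            (simp add: Tz flip: scaleR_sum_left sum_divide_distrib sum_distrib_left)
        also have "(\<Sum>s<3. \<Sum>t<3. (x s y * z t y / T) *\<^sub>R f t) = (\<Sum>t<3. z t y *\<^sub>R f t)"
          using False by (subst sum.swap, intro sum.cong refl)
            (simp add: T_def flip: scaleR_sum_left sum_divide_distrib sum_distrib_right)
        finally show ?thesis using yeq by simp
      qed
      also have "\<dots> \<in> convex_cone hull W"
      proof -
        have sum_in: "sum g A \<in> convex_cone hull W" if "\<And>i. i \<in> A \<Longrightarrow> g i \<in> convex_cone hull W"
          for g :: "nat \<Rightarrow> nat \<Rightarrow>\<^sub>0 real" and A
          using that by (induction A rule: infinite_finite_induct)
            (auto simp: convex_cone_hull_contains_0 convex_cone_hull_add)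
        show ?thesis
          using nn T0 by (intro sum_in convex_cone_hull_mul hull_inc divide_nonneg_nonneg mult_nonneg_nonneg)
            (auto simp: W_def)
      qed
      finally show "y \<in> convex_cone hull W" .
    qed
    have "subspace (M \<inter> {y. Poly_Mapping.keys y \<subseteq> {k..<k + 6}})"
      by (intro subspace_inter M subspace_keys_subset)
    from convex_cone_nonneg_coords[OF this] have "convex_cone ?K"
      by (simp add: conj_assoc)
    moreover have "W \<subseteq> ?K"
    proof -
      have "e s + f t \<in> ?K" if "s < 3" "t < 3" for s t
      proof -
        have "e s + f t \<in> M"
          using that xe xf linx by (auto simp: M_def linear_add)
        moreover have "Poly_Mapping.lookup (e s + f t) i = 0" if "i \<notin> {k..<k + 6}" for i
          using that \<open>s < 3\<close> \<open>t < 3\<close> by (auto simp: e_def f_def lookup_add lookup_single when_def)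
        moreover have "0 \<le> Poly_Mapping.lookup (e s + f t) i" for i
          by (auto simp: e_def f_def lookup_add lookup_single when_def)
        ultimately show ?thesis by (simp add: keys_subset_iff)
      qed
      then show ?thesis by (auto simp: W_def)
    qed
    ultimately show "convex_cone hull W \<subseteq> ?K" by (intro hull_minimal)
  qed
  define g where "g y = (\<Sum>s<3. x s y *\<^sub>R a s) + (\<Sum>t<3. z t y *\<^sub>R b t)" for y
  have g: "linear g"
    using linx by (auto simp: g_def linear_iff sum.distrib scaleR_add_left scaleR_add_right scaleR_sum_right)
  have "g (e s + f t) = a s + b t" if "s < 3" "t < 3" for s t
    using that xe xf linx by (auto simp: g_def linear_add if_distrib[of "\<lambda>c. c *\<^sub>R _"] cong: if_cong)
  then have "g ` W = (\<lambda>(s, t). a s + b t) ` ({..<3} \<times> {..<3})"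
    unfolding W_def image_image by (intro image_cong) auto
  with cone_extension_Un[OF assms M _ g K] show ?thesis
    by (simp add: W_def)
qed

section \<open>Polytopes as slices of cones\<close>

definition dehom :: "'a::real_vector \<times> real \<Rightarrow> 'a" where
  "dehom s = (1 / snd s) *\<^sub>R fst s"

text \<open>The height \<open>h\<close> of the image is positive on the generators, so the slice
  \<open>h y = 1\<close> of the cone is the hull of the rescaled generators. The slice is cut from
  an affine set by \<open>k\<close> inequalities, and \<open>card_facets_le\<close> bounds its
  facets.\<close>

lemma extension_complexity_le_cone_extension:
  fixes S :: "('a::real_vector \<times> real) set"
  assumes "cone_extension k S" and pos: "\<And>s. s \<in> S \<Longrightarrow> 0 < snd s"
  shows "extension_complexity (convex hull (dehom ` S)) \<le> enat k"
proof -
  obtain L W g where L: "subspace L" and W: "finite W" and g: "linear g" and S: "g ` W = S"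
    and eq: "{y \<in> coord_space k \<inter> L. \<forall>i. 0 \<le> Poly_Mapping.lookup y i} = convex_cone hull W"
    using assms(1) unfolding cone_extension_def by blast
  define h where "h y = snd (g y)" for y
  have h: "linear h"
    using linear_compose[OF g linear_snd] by (simp add: h_def[abs_def] o_def)
  have hW: "0 < h w" if "w \<in> W" for w
    unfolding h_def using that S by (intro pos) blast
  define W' where "W' = (\<lambda>w. (1 / h w) *\<^sub>R w) ` W"
  define M where "M = coord_space k \<inter> L \<inter> {y. h y = 1}"
  define Q where "Q = convex hull W'"
  have hW': "h w = 1" if "w \<in> W'" for w
    using that hW by (force simp: W'_def linear_scale[OF h])
  have affh: "affine {y. h y = 1}"
    by (auto simp: affine_def linear_add[OF h] linear_scale[OF h])
  have W'_sub: "W' \<subseteq> convex_cone hull W"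
    using hW by (auto simp: W'_def less_imp_le intro!: convex_cone_hull_mul[OF hull_inc])
  have Q_sub: "Q \<subseteq> convex_cone hull W"
    unfolding Q_def by (intro hull_minimal W'_sub convex_convex_cone_hull)
  have hQ: "h y = 1" if "y \<in> Q" for y
  proof -
    have "Q \<subseteq> {y. h y = 1}"
      unfolding Q_def using hW' affh by (intro hull_minimal affine_imp_convex) auto
    then show ?thesis using that by auto
  qed
  have Q: "Q = {y \<in> M. \<forall>i\<in>{..<k}. 0 \<le> Poly_Mapping.lookup y i}"
  proof
    show "Q \<subseteq> {y \<in> M. \<forall>i\<in>{..<k}. 0 \<le> Poly_Mapping.lookup y i}"
      using Q_sub hQ by (auto simp: eq[symmetric] M_def)
    show "{y \<in> M. \<forall>i\<in>{..<k}. 0 \<le> Poly_Mapping.lookup y i} \<subseteq> Q"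
    proof
      fix y assume y: "y \<in> {y \<in> M. \<forall>i\<in>{..<k}. 0 \<le> Poly_Mapping.lookup y i}"
      then have "0 \<le> Poly_Mapping.lookup y i" for i
        by (cases "i < k") (auto simp: M_def coord_space_iff not_less)
      then have "y \<in> convex_cone hull W"
        using y by (auto simp: eq[symmetric] M_def)
      \<comment> \<open>Rescaling generators by positive factors does not change the cone.\<close>
      also have "\<dots> \<subseteq> convex_cone hull W'"
      proof (rule hull_minimal)
        show "W \<subseteq> convex_cone hull W'"
        proof
          fix w assume w: "w \<in> W"
          then have "h w *\<^sub>R ((1 / h w) *\<^sub>R w) \<in> convex_cone hull W'"
            using hW[OF w] by (intro convex_cone_hull_mul[of "(1 / h w) *\<^sub>R w"] hull_inc) (auto simp: W'_def)
          then show "w \<in> convex_cone hull W'" using hW[OF w] by simp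
        qed
      qed (rule convex_cone_convex_cone_hull)
      \<comment> \<open>\<open>h y = 1\<close> rules out \<open>y = 0\<close> and forces
        \<open>c = 1\<close>, as \<open>h\<close> is 1 on \<open>Q\<close>.\<close>
      finally have "y = 0 \<or> (\<exists>x c. x \<in> Q \<and> 0 \<le> c \<and> y = c *\<^sub>R x)"
        unfolding convex_cone_hull_convex_hull Q_def by auto
      moreover have "h y = 1" using y by (simp add: M_def)
      ultimately obtain x c where "x \<in> Q" "y = c *\<^sub>R x"
        using linear_0[OF h] by auto
      moreover then have "c = 1"
        using hQ \<open>h y = 1\<close> by (simp add: linear_scale[OF h])
      ultimately show "y \<in> Q" by simp
    qed
  qed
  have Qk: "Q \<subseteq> coord_space k"
    unfolding Q M_def by blast
  have "polytope Q"
    unfolding Q_def polytope_def W'_def using W by blast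
  moreover have lin: "linear (\<lambda>y. fst (g y))"
    using linear_compose[OF g linear_fst] by (simp add: o_def)
  moreover have "(\<lambda>y. fst (g y)) ` Q = convex hull (dehom ` S)"
  proof -
    have "(\<lambda>y. fst (g y)) ` W' = dehom ` S"
      unfolding W'_def S[symmetric] image_image
      by (intro image_cong) (auto simp: dehom_def h_def linear_scale[OF g])
    then show ?thesis
      unfolding Q_def by (metis convex_hull_linear_image lin)
  qed
  ultimately have "is_extension k Q (convex hull (dehom ` S))"
    unfolding is_extension_def using Qk by blast
  then have "extension_complexity (convex hull (dehom ` S)) \<le> enat (card {F. is_facet F Q})"
    unfolding extension_complexity_def by (intro INF_lower2[of "(k, Q)"]) auto
  also have "card {F. is_facet F Q} \<le> card {..<k}"
  proof (rule card_facets_le[OF Q])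
    have "affine (coord_space k \<inter> L)"
      using L subspace_coord_space by (intro subspace_imp_affine subspace_inter)
    then show "affine M"
      unfolding M_def using affh by (rule affine_Int)
    show "Q \<subseteq> span ((\<lambda>i. Poly_Mapping.single i 1) ` {..<k})"
      using Qk coord_space_subset_span by blast
  qed (auto simp: linear_lookup)
  finally show ?thesis by simp
qed

subsection \<open>Points in convex position\<close>

text \<open>The determinant with rows \<open>u\<close>, \<open>v\<close>, \<open>w\<close>. At
  height 1 it is twice the signed area of a triangle, positive for counterclockwise order.\<close>

definition hdet :: "(real ^ 2) \<times> real \<Rightarrow> (real ^ 2) \<times> real \<Rightarrow> (real ^ 2) \<times> real \<Rightarrow> real" where
  "hdet u v w =
     fst u $ 1 * (fst v $ 2 * snd w - snd v * fst w $ 2)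
   - fst u $ 2 * (fst v $ 1 * snd w - snd v * fst w $ 1)
   + snd u * (fst v $ 1 * fst w $ 2 - fst v $ 2 * fst w $ 1)"

lemma hdet_add: "hdet u v (x + y) = hdet u v x + hdet u v y"
  and hdet_diff: "hdet u v (x - y) = hdet u v x - hdet u v y"
  and hdet_scaleR: "hdet u v (c *\<^sub>R x) = c * hdet u v x"
  and hdet_0: "hdet u v 0 = 0"
  by (simp_all add: hdet_def algebra_simps)

lemma hdet_same: "hdet u v u = 0" "hdet u v v = 0" "hdet u u v = 0"
  by (simp_all add: hdet_def algebra_simps)

lemma hdet_rotate: "hdet v w u = hdet u v w"
  by (simp add: hdet_def algebra_simps)

lemma hdet_swap: "hdet u w v = - hdet u v w"
  by (simp add: hdet_def algebra_simps)

text \<open>Cramer's rule for four vectors of a three-dimensional space.\<close>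

lemma hdet_cramer:
  "hdet b c d *\<^sub>R a - hdet a c d *\<^sub>R b + hdet a b d *\<^sub>R c - hdet a b c *\<^sub>R d = 0"
  by (simp add: prod_eq_iff vec_eq_iff forall_2 hdet_def algebra_simps)

text \<open>The three-term Pluecker relation for the 2x2 minors left after projecting along
  \<open>a\<close>.\<close>

lemma hdet_pluecker: "hdet a b d * hdet a c e = hdet a b c * hdet a d e + hdet a b e * hdet a c d"
  unfolding hdet_def by algebra

text \<open>For \<open>p 1\<close>, ..., \<open>p 6\<close> in the order a, b, c, d, e, f, the first
  two terms are the difference of the right-hand sides of \<open>condB\<close> and
  \<open>condA\<close>; the relation rewrites this difference by other minors.\<close>

lemma hdet_six_points:
  "hdet a b e * hdet c d f - hdet a c d * hdet b e f + hdet a d f * hdet b c e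
   - hdet a c f * hdet b d e = 0"
  unfolding hdet_def by algebra

text \<open>The hypotheses make both products on the right of the Pluecker relation nonnegative.
  They hold when \<open>b\<close>, \<open>c\<close>, \<open>d\<close>, \<open>e\<close> appear in
  this counterclockwise order around \<open>a\<close>, within a half-turn.\<close>

lemma hdet_crossing:
  assumes "0 \<le> hdet a b c" "0 \<le> hdet a d e" "0 \<le> hdet a b e" "0 \<le> hdet a c d"
  shows "hdet a b c * hdet a d e \<le> hdet a b d * hdet a c e"
    and "hdet a b e * hdet a c d \<le> hdet a b d * hdet a c e"
  unfolding hdet_pluecker[of a b d c e] using assms by auto

text \<open>Start at one vertex \<open>p\<close> and sort the others by slope as seen from
  \<open>p\<close>; a line separating \<open>p\<close> from them makes slopes meaningful. Triples
  containing \<open>p\<close> are then positive by construction. A nonpositive triple without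
  \<open>p\<close> would put its middle point into a triangle of other vertices.\<close>

lemma exists_convex_ordering:
  fixes V :: "(real ^ 2) set"
  assumes V: "finite V" "card V = n" "\<And>v. v \<in> V \<Longrightarrow> v \<notin> convex hull (V - {v})"
  obtains v where "v ` {..<n} = V"
    "\<And>i j k. i < j \<Longrightarrow> j < k \<Longrightarrow> k < n \<Longrightarrow> 0 < hdet (v i, 1) (v j, 1) (v k, 1)"
proof (cases "n = 0")
  case True
  then show ?thesis using V that by auto
next
  case False
  then obtain p where p: "p \<in> V" using V by fastforce
  define U where "U = V - {p}"
  have U: "finite U" "card U = n - 1" "p \<notin> U" "V = insert p U"
    using V p by (auto simp: U_def)
  have "closed (convex hull U)"
    using U(1) by (simp add: compact_imp_closed finite_imp_compact_convex_hull)
  then obtain a b where ab: "a \<bullet> p < b" "\<And>x. x \<in> convex hull U \<Longrightarrow> b < a \<bullet> x"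
    using separating_hyperplane_closed_point[of "convex hull U" p] V(3)[OF p]
    by (auto simp: U_def)
  \<comment> \<open>\<open>d\<close> is \<open>a\<close> turned by a right angle, so up to scaling
    \<open>X\<close> and \<open>Y\<close> are orthogonal coordinates around
    \<open>p\<close>.\<close>
  define d :: "real ^ 2" where "d = vector [- a $ 2, a $ 1]"
  define X where "X u = a \<bullet> (u - p)" for u
  define Y where "Y u = d \<bullet> (u - p)" for u
  define key where "key u = Y u / X u" for u
  have X: "0 < X u" if "u \<in> U" for u
    using ab(1) ab(2)[OF hull_inc[OF that]] by (simp add: X_def inner_diff_right)
  have aa: "0 < a \<bullet> a" if "u \<in> U" for u
    using X[OF that] by (auto simp: X_def)
  have det: "(a \<bullet> a) * hdet (p, 1) (u, 1) (w, 1) = X u * Y w - Y u * X w" for u w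
    by (simp add: hdet_def X_def Y_def d_def inner_vec_def sum_2 algebra_simps)
  have key_less: "0 < hdet (p, 1) (u, 1) (w, 1)" if "u \<in> U" "w \<in> U" "key u < key w" for u w
  proof -
    have "0 < X u * Y w - Y u * X w"
      using that(3) X[OF that(1)] X[OF that(2)] by (simp add: key_def field_simps)
    then show ?thesis
      using aa[OF that(1)] det[of u w] by (metis zero_less_mult_pos)
  qed
  \<comment> \<open>Equal slopes mean the same ray from \<open>p\<close>; the nearer point would lie
    on the segment from \<open>p\<close> to the farther one.\<close>
  have inj: "inj_on key U"
  proof -
    have False if uw: "u \<in> U" "w \<in> U" "u \<noteq> w" "key u = key w" "X u \<le> X w" for u w
    proof -
      have "X u * Y w = Y u * X w"
        using uw(4) X[OF uw(1)] X[OF uw(2)] by (simp add: key_def field_simps)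
      define t where "t = X u / X w"
      have t: "0 \<le> t" "t \<le> 1"
        using X[OF uw(1)] X[OF uw(2)] uw(5) by (auto simp: t_def)
      have Xt: "X u = t * X w" and Yt: "Y u = t * Y w"
        using X[OF uw(2)] \<open>X u * Y w = Y u * X w\<close> by (auto simp: t_def field_simps)
      have "(a \<bullet> a) *\<^sub>R y = (a \<bullet> y) *\<^sub>R a + (d \<bullet> y) *\<^sub>R d" for y
        by (simp add: vec_eq_iff forall_2 d_def inner_vec_def sum_2 algebra_simps)
      then have "(a \<bullet> a) *\<^sub>R (u - p) = (a \<bullet> a) *\<^sub>R (t *\<^sub>R (w - p))"
        using Xt Yt unfolding X_def Y_def
        by (metis (no_types, lifting) inner_scaleR_right)
      then have "u - p = t *\<^sub>R (w - p)"
        by (rule scaleR_left_imp_eq[rotated]) (use aa[OF uw(1)] in simp)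
      then have "u = (1 - t) *\<^sub>R p + t *\<^sub>R w" by (simp add: algebra_simps)
      moreover have "(1 - t) *\<^sub>R p + t *\<^sub>R w \<in> convex hull (V - {u})"
        using t uw U p by (intro convexD[OF convex_convex_hull] hull_inc) auto
      ultimately show False using V(3)[of u] uw(1) U(4) by simp
    qed
    then show ?thesis
      unfolding inj_on_def by (metis nle_le)
  qed
  define xs where "xs = sorted_list_of_set (key ` U)"
  have xs: "set xs = key ` U" "sorted_wrt (<) xs" "length xs = n - 1"
    using U inj by (auto simp: xs_def card_image)
  define v where "v i = (case i of 0 \<Rightarrow> p | Suc i \<Rightarrow> inv_into U key (xs ! i))" for i
  have key_v: "v (Suc i) \<in> U" "key (v (Suc i)) = xs ! i" if "i < n - 1" for i
    using that xs(1,3) nth_mem[of i xs] by (auto simp: v_def inv_into_into f_inv_into_f)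
  have vU: "v i \<in> U" if "0 < i" "i < n" for i
    using key_v(1)[of "i - 1"] that by simp
  have key_mono: "key (v i) < key (v j)" if "0 < i" "i < j" "j < n" for i j
    using key_v(2)[of "i - 1"] key_v(2)[of "j - 1"] that xs(2,3)
      sorted_wrt_nth_less[OF xs(2), of "i - 1" "j - 1"] by auto
  have pos0: "0 < hdet (p, 1) (v i, 1) (v j, 1)" if "0 < i" "i < j" "j < n" for i j
    using key_less[OF vU vU key_mono] that by simp
  show ?thesis
  proof
    have "{..<n} = insert 0 (Suc ` {..<n - 1})"
      using False lessThan_Suc_eq_insert_0[of "n - 1"] by simp
    moreover have "v ` Suc ` {..<n - 1} = inv_into U key ` (\<lambda>i. xs ! i) ` {..<length xs}"
      by (simp add: v_def image_image xs(3))
    moreover have "(\<lambda>i. xs ! i) ` {..<length xs} = set xs"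
      by (auto simp: set_conv_nth)
    moreover have "inv_into U key ` set xs = U"
      using inv_into_image_cancel[OF inj, of U] xs(1) by simp
    ultimately show "v ` {..<n} = V"
      using U(4) by (simp add: v_def)
  next
    fix i j k :: nat
    assume ijk: "i < j" "j < k" "k < n"
    show "0 < hdet (v i, 1) (v j, 1) (v k, 1)"
    proof (cases "i = 0")
      case True
      then show ?thesis using pos0[of j k] ijk by (simp add: v_def)
    next
      case False
      show ?thesis
      proof (rule ccontr)
        assume neg: "\<not> ?thesis"
        define h0 where "h0 = hdet (v i, 1) (v j, 1) (v k, 1)"
        define h1 where "h1 = hdet (p, 1) (v j, 1) (v k, 1)"
        define h2 where "h2 = hdet (p, 1) (v i, 1) (v k, 1)"
        define h3 where "h3 = hdet (p, 1) (v i, 1) (v j, 1)"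
        have h: "h0 \<le> 0" "0 < h1" "0 < h2" "0 < h3"
          using neg pos0 ijk False by (auto simp: h0_def h1_def h2_def h3_def)
        \<comment> \<open>Cramer's relation and its height component. Solved for \<open>v j\<close>,
          it gives a convex combination, because \<open>h0 \<le> 0\<close>.\<close>
        have eq: "h0 *\<^sub>R p - h1 *\<^sub>R v i + h2 *\<^sub>R v j - h3 *\<^sub>R v k = 0" "h0 - h1 + h2 - h3 = 0"
          using hdet_cramer[of "(v i, 1)" "(v j, 1)" "(v k, 1)" "(p, 1)"]
          by (simp_all add: prod_eq_iff h0_def h1_def h2_def h3_def)
        have "h2 *\<^sub>R v j = h2 *\<^sub>R ((- h0 / h2) *\<^sub>R p + (h1 / h2) *\<^sub>R v i + (h3 / h2) *\<^sub>R v k)"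
          using h(3) eq(1) by (simp add: scaleR_add_right algebra_simps)
        then have "v j = (- h0 / h2) *\<^sub>R p + (h1 / h2) *\<^sub>R v i + (h3 / h2) *\<^sub>R v k"
          using h(3) by simp
        moreover have "- h0 / h2 + h1 / h2 + h3 / h2 = 1"
          using h(3) eq(2) by (simp add: field_simps)
        moreover have "0 \<le> - h0 / h2" "0 \<le> h1 / h2" "0 \<le> h3 / h2"
          using h by (auto simp: divide_nonpos_pos)
        ultimately have "v j \<in> convex hull {p, v i, v k}"
          unfolding convex_hull_3 by blast
        moreover have "v i \<noteq> v j" "v k \<noteq> v j" "v j \<noteq> p"
          using key_mono[of i j] key_mono[of j k] vU[of j] False ijk U(3) by auto
        then have "{p, v i, v k} \<subseteq> V - {v j}"
          using vU[of i] vU[of k] ijk False U(4) by auto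
        ultimately have "v j \<in> convex hull (V - {v j})"
          by (meson hull_mono subsetD)
        then show False using V(3) vU[of j] ijk U(4) by auto
      qed
    qed
  qed
qed

text \<open>Triangulate from \<open>p 0\<close>. Along the fan \<open>hdet (p 0) (p i) x\<close>
  goes from nonnegative at \<open>i = 1\<close> to nonpositive at \<open>i = n - 1\<close>, so it
  changes sign between neighbours; Cramer's rule then expresses \<open>x\<close> by that
  triangle.\<close>

lemma in_convex_cone_hull_fan:
  assumes pos: "\<And>i j. 0 < i \<Longrightarrow> i < j \<Longrightarrow> j < n \<Longrightarrow> 0 < hdet (p 0) (p i) (p j)"
    and n: "3 \<le> n"
    and x: "\<And>i. Suc i < n \<Longrightarrow> 0 \<le> hdet (p i) (p (Suc i)) x" "0 \<le> hdet (p (n - 1)) (p 0) x"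
  shows "x \<in> convex_cone hull (p ` {..<n})"
proof -
  \<comment> \<open>\<open>P i\<close> says that \<open>x\<close> is not beyond the far side of the
    triangle on \<open>p 0\<close>, \<open>p i\<close>, \<open>p (Suc i)\<close>. The least such
    positive \<open>i\<close> below \<open>n - 2\<close> is used, or \<open>n - 2\<close> itself if
    there is none.\<close>
  define P where "P i \<longleftrightarrow> hdet (p 0) (p (Suc i)) x \<le> 0" for i
  have "hdet (p 0) (p (n - 1)) x \<le> 0"
    using x(2) hdet_rotate[of "p 0" x "p (n - 1)"] hdet_swap[of "p 0" x "p (n - 1)"] by simp
  then have "P (n - 2)" using n by (simp add: P_def numeral_2_eq_2 Suc_diff_Suc)
  have "\<exists>i. 0 < i \<and> Suc i < n \<and> 0 \<le> hdet (p 0) (p i) x \<and> hdet (p 0) (p (Suc i)) x \<le> 0"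
  proof (cases "\<exists>i<n - 2. 0 < i \<and> P i")
    case True
    define i where "i = (LEAST i. 0 < i \<and> P i)"
    have i: "0 < i" "P i"
      using LeastI_ex[of "\<lambda>i. 0 < i \<and> P i"] True by (auto simp: i_def)
    have "i < n - 2"
      using Least_le[of "\<lambda>i. 0 < i \<and> P i"] True by (auto simp: i_def intro: le_less_trans)
    moreover have "0 \<le> hdet (p 0) (p i) x"
    proof (cases "i = 1")
      case True
      then show ?thesis using x(1)[of 0] n by simp
    next
      case False
      then have "\<not> P (i - 1)"
        using not_less_Least[of "i - 1" "\<lambda>i. 0 < i \<and> P i"] i(1) by (auto simp: i_def[symmetric])
      then show ?thesis using i(1) by (simp add: P_def)
    qed
    ultimately show ?thesis using i by (intro exI[of _ i]) (auto simp: P_def)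
  next
    case False
    have "0 \<le> hdet (p 0) (p (n - 2)) x"
    proof (cases "n = 3")
      case True
      then show ?thesis using x(1)[of 0] by simp
    next
      case f: False
      then have "n - 3 < n - 2" "0 < n - 3" using n by auto
      then have "\<not> P (n - 3)" using False by blast
      moreover have "Suc (n - 3) = n - 2" using n by simp
      ultimately show ?thesis by (simp add: P_def)
    qed
    then show ?thesis
      using \<open>P (n - 2)\<close> n by (intro exI[of _ "n - 2"]) (auto simp: P_def)
  qed
  then obtain i where i: "0 < i" "Suc i < n" "0 \<le> hdet (p 0) (p i) x" "hdet (p 0) (p (Suc i)) x \<le> 0"
    by blast
  define h where "h = hdet (p 0) (p i) (p (Suc i))"
  have h: "0 < h" using pos[of i "Suc i"] i by (simp add: h_def)
  have "h *\<^sub>R x = hdet (p i) (p (Suc i)) x *\<^sub>R p 0 + (- hdet (p 0) (p (Suc i)) x) *\<^sub>R p i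
      + hdet (p 0) (p i) x *\<^sub>R p (Suc i)"
    using hdet_cramer[of "p i" "p (Suc i)" x "p 0"] by (simp add: h_def algebra_simps)
  also have "\<dots> \<in> convex_cone hull (p ` {..<n})"
    using i x(1)[of i] n by (intro convex_cone_hull_add convex_cone_hull_mul hull_inc) auto
  finally have "(1 / h) *\<^sub>R (h *\<^sub>R x) \<in> convex_cone hull (p ` {..<n})"
    using h by (intro convex_cone_hull_mul[of "h *\<^sub>R x"]) simp_all
  then show ?thesis using h by simp
qed

subsection \<open>Heptagons\<close>

text \<open>The product of two Pluecker inequalities, one seen from \<open>a\<close> and one from
  \<open>e\<close>, with the common positive factors cancelled.\<close>

lemma hdet_lines_ratio:
  assumes "0 \<le> hdet a b d" "0 \<le> hdet a c e" "0 \<le> hdet a b e" "0 \<le> hdet a c d"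
    "0 \<le> hdet a d e" "0 \<le> hdet a b c" "0 \<le> hdet e f a" "0 \<le> hdet e c d"
    "0 < hdet e a d" "0 \<le> hdet e f c" "0 \<le> hdet e f d" "0 < hdet e a c"
  shows "hdet a b c * hdet e f d \<le> hdet a b d * hdet e f c"
proof -
  have 1: "hdet a b c * hdet a d e \<le> hdet a b d * hdet a c e"
    by (rule hdet_crossing) fact+
  have 2: "hdet e f d * hdet e a c \<le> hdet e f c * hdet e a d"
    using hdet_pluecker[of e f a c d] mult_nonneg_nonneg[OF assms(7,8)] hdet_swap[of e a c]
    by simp
  have r: "hdet a c e = hdet e a c" "hdet a d e = hdet e a d"
    using hdet_rotate[of a c e] hdet_rotate[of a d e] hdet_rotate[of e a c] hdet_rotate[of e a d]
    by simp_all
  have "hdet a b c * hdet e f d * (hdet e a d * hdet e a c) =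
      (hdet a b c * hdet e a d) * (hdet e f d * hdet e a c)" by simp
  also have "\<dots> \<le> (hdet a b d * hdet e a c) * (hdet e f c * hdet e a d)"
    using 1 2 assms unfolding r by (intro mult_mono[OF 1[unfolded r] 2]) simp_all
  also have "\<dots> = hdet a b d * hdet e f c * (hdet e a d * hdet e a c)" by simp
  finally show ?thesis
    using assms(9,12) by (simp add: mult_le_cancel_right)
qed

text \<open>
  Equality in \<open>condA\<close> means that the lines \<open>p 1 p 4\<close>, \<open>p 2 p 3\<close>, \<open>p 5 p 6\<close> are concurrent, and
  equality in \<open>condB\<close> that \<open>p 3 p 6\<close>, \<open>p 4 p 5\<close>, \<open>p 1 p 2\<close> are; reversing the order of the six
  points exchanges the two.
\<close>

definition condA :: "(nat \<Rightarrow> (real ^ 2) \<times> real) \<Rightarrow> bool" where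
  "condA p \<longleftrightarrow> hdet (p 1) (p 2) (p 4) * hdet (p 3) (p 5) (p 6) \<le>
     hdet (p 1) (p 3) (p 4) * hdet (p 2) (p 5) (p 6)"

definition condB :: "(nat \<Rightarrow> (real ^ 2) \<times> real) \<Rightarrow> bool" where
  "condB p \<longleftrightarrow> hdet (p 1) (p 2) (p 4) * hdet (p 3) (p 5) (p 6) \<le>
     hdet (p 1) (p 2) (p 5) * hdet (p 3) (p 4) (p 6)"

text \<open>Labels run over all of \<open>nat\<close> with period 7, and positivity is asked in
  every window of one period, so the assumptions are invariant under a change of the starting
  vertex.\<close>

locale heptagon =
  fixes p :: "nat \<Rightarrow> (real ^ 2) \<times> real"
  assumes periodic: "p (i + 7) = p i"
    and hdet_pos: "i < j \<Longrightarrow> j < k \<Longrightarrow> k < i + 7 \<Longrightarrow> 0 < hdet (p i) (p j) (p k)"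
begin

lemma heptagon_shift: "heptagon (\<lambda>i. p (i + m))"
proof
  show "p (i + 7 + m) = p (i + m)" for i
    using periodic[of "i + m"] by (simp add: ac_simps)
qed (simp add: hdet_pos)

lemma wrap: "p 7 = p 0" "p 8 = p 1" "p 9 = p 2" "p 10 = p 3" "p 11 = p 4" "p 12 = p 5"
  using periodic[of 0] periodic[of 1] periodic[of 2] periodic[of 3] periodic[of 4] periodic[of 5]
  by simp_all

lemma range_eq: "range p = p ` {..<7}"
proof -
  have "p (7 * m + i) = p i" for m i
  proof (induction m)
    case (Suc m)
    then show ?case using periodic[of "7 * m + i"] by (simp add: ac_simps)
  qed simp
  then have "p i = p (i mod 7)" for i
    by (metis mult_div_mod_eq)
  then show ?thesis by (auto simp: image_iff) (metis lessThan_iff mod_less_divisor zero_less_numeral)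
qed

text \<open>If both fail, then \<open>x * a < y * b\<close> and \<open>y * c < x * d\<close> in the
  abbreviations below; the shift by 5 is what makes the two share \<open>x\<close> and
  \<open>y\<close>. The crossing inequality at \<open>p 6\<close> gives
  \<open>d * b \<le> c * a\<close>, which closes a contradictory cycle.\<close>

lemma condA_or_condB: "condA p \<or> condB (\<lambda>i. p (i + 5))"
proof (rule ccontr)
  assume neg: "\<not> ?thesis"
  define x where "x = hdet (p 1) (p 3) (p 4)"
  define y where "y = hdet (p 1) (p 2) (p 4)"
  define a where "a = hdet (p 2) (p 5) (p 6)"
  define b where "b = hdet (p 3) (p 5) (p 6)"
  define c where "c = hdet (p 6) (p 7) (p 10)"
  define d where "d = hdet (p 6) (p 7) (p 9)"
  have pos: "0 < x" "0 < y" "0 < a" "0 < b" "0 < c" "0 < d"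
    by (simp_all add: x_def y_def a_def b_def c_def d_def hdet_pos)
  have "x * a < y * b"
    using neg by (simp add: condA_def x_def y_def a_def b_def)
  then have 1: "(x * a) * c < (y * b) * c" using pos by simp
  have "y * c < x * d"
    using neg by (simp add: condB_def x_def y_def c_def d_def wrap ac_simps)
  then have 2: "(y * c) * b < (x * d) * b" using pos by simp
  have "d * hdet (p 6) (p 10) (p 12) \<le> c * hdet (p 6) (p 9) (p 12)"
    unfolding c_def d_def by (rule hdet_crossing) (simp_all add: hdet_pos less_imp_le)
  then have "d * b \<le> c * a"
    using hdet_rotate[of "p 3" "p 5" "p 6"] hdet_rotate[of "p 2" "p 5" "p 6"]
    by (simp add: a_def b_def wrap)
  then have "x * (d * b) \<le> x * (c * a)" using pos by simp
  with 1 2 show False by (simp add: ac_simps)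
qed

text \<open>If \<open>condB p\<close> holds and \<open>condA p\<close> fails, the right-hand side of
  \<open>condB\<close> exceeds that of \<open>condA\<close>, and the six-point relation reads this
  as \<open>q * e < s * d\<close>. Failure of the shifted \<open>condA\<close> and the crossing
  inequality at \<open>p 6\<close> contradict it.\<close>

lemma condA_or_condA_or_not_condB: "condA p \<or> condA (\<lambda>i. p (i + 1)) \<or> \<not> condB p"
proof (rule ccontr)
  assume neg: "\<not> ?thesis"
  define d where "d = hdet (p 2) (p 4) (p 5)"
  define e where "e = hdet (p 2) (p 3) (p 5)"
  define s where "s = hdet (p 1) (p 3) (p 6)"
  define q where "q = hdet (p 1) (p 4) (p 6)"
  define x where "x = hdet (p 3) (p 6) (p 7)"
  define y where "y = hdet (p 4) (p 6) (p 7)"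
  have pos: "0 < d" "0 < e" "0 < s" "0 < q" "0 < x" "0 < y"
    by (simp_all add: d_def e_def s_def q_def x_def y_def hdet_pos)
  have 1: "q * e < s * d"
    using neg hdet_six_points[of "p 1" "p 2" "p 5" "p 3" "p 4" "p 6"]
    by (simp add: condA_def condB_def d_def e_def s_def q_def)
  have 2: "d * x < e * y"
    using neg by (simp add: condA_def d_def e_def x_def y_def del: One_nat_def)
  have "hdet (p 6) (p 7) (p 11) * hdet (p 6) (p 8) (p 10)
      \<le> hdet (p 6) (p 7) (p 10) * hdet (p 6) (p 8) (p 11)"
    by (rule hdet_crossing) (simp_all add: hdet_pos less_imp_le)
  then have 3: "y * s \<le> x * q"
    using hdet_rotate[of "p 4" "p 6" "p 0"] hdet_rotate[of "p 6" "p 0" "p 4"]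
      hdet_rotate[of "p 3" "p 6" "p 0"] hdet_rotate[of "p 6" "p 0" "p 3"]
      hdet_rotate[of "p 1" "p 3" "p 6"] hdet_rotate[of "p 1" "p 4" "p 6"]
    by (simp add: x_def y_def s_def q_def wrap)
  have "(d * x) * s < (e * y) * s" using 2 pos by simp
  also have "\<dots> = e * (y * s)" by simp
  also have "\<dots> \<le> e * (x * q)" using 3 pos by simp
  also have "\<dots> = x * (q * e)" by simp
  also have "\<dots> < x * (s * d)" using 1 pos by simp
  finally show False by (simp add: ac_simps)
qed

text \<open>The mirror image of the preceding lemma: reversing the labels exchanges
  \<open>condA\<close> with \<open>condB\<close> and a shift by 1 with a shift by 6.\<close>

lemma condB_or_condB_or_not_condA: "condB p \<or> condB (\<lambda>i. p (i + 6)) \<or> \<not> condA p"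
proof (rule ccontr)
  assume neg: "\<not> ?thesis"
  define d where "d = hdet (p 2) (p 4) (p 5)"
  define e where "e = hdet (p 2) (p 3) (p 5)"
  define s where "s = hdet (p 1) (p 3) (p 6)"
  define q where "q = hdet (p 1) (p 4) (p 6)"
  define x where "x = hdet (p 0) (p 1) (p 4)"
  define y where "y = hdet (p 0) (p 1) (p 3)"
  have pos: "0 < d" "0 < e" "0 < s" "0 < q" "0 < x" "0 < y"
    by (simp_all add: d_def e_def s_def q_def x_def y_def hdet_pos)
  have 1: "s * d < q * e"
    using neg hdet_six_points[of "p 1" "p 2" "p 5" "p 3" "p 4" "p 6"]
    by (simp add: condA_def condB_def d_def e_def s_def q_def)
  have 2: "e * x < d * y"
    using neg by (simp add: condB_def d_def e_def x_def y_def wrap ac_simps)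
  have "hdet (p 1) (p 3) (p 7) * hdet (p 1) (p 4) (p 6)
      \<le> hdet (p 1) (p 3) (p 6) * hdet (p 1) (p 4) (p 7)"
    by (rule hdet_crossing) (simp_all add: hdet_pos less_imp_le)
  then have 3: "y * q \<le> s * x"
    using hdet_rotate[of "p 1" "p 3" "p 0"] hdet_rotate[of "p 1" "p 4" "p 0"]
    by (simp add: x_def y_def s_def q_def wrap)
  have "(e * x) * q < (d * y) * q" using 2 pos by simp
  also have "\<dots> = d * (y * q)" by simp
  also have "\<dots> \<le> d * (s * x)" using 3 pos by simp
  also have "\<dots> = x * (s * d)" by simp
  also have "\<dots> < x * (q * e)" using 1 pos by simp
  finally show False by (simp add: ac_simps)
qed

lemma exists_good_labelling: "\<exists>m. condA (\<lambda>i. p (i + m + 6)) \<and> condB (\<lambda>i. p (i + m))"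
proof -
  define a where "a m = condA (\<lambda>i. p (i + m))" for m
  define b where "b m = condB (\<lambda>i. p (i + m))" for m
  have per: "a (m + 7) = a m" "b (m + 7) = b m" for m
    using periodic[of "_ + m"] by (simp_all add: a_def b_def flip: add.assoc)
  note w = per[of 0] per[of 1] per[of 2] per[of 3] per[of 4] per[of 5] per[of 6]
  have i: "a m \<or> b (m + 5)" for m
    using heptagon.condA_or_condB[OF heptagon_shift[of m]] by (simp add: a_def b_def ac_simps)
  have ii: "a m \<or> a (m + 1) \<or> \<not> b m" for m
    using heptagon.condA_or_condA_or_not_condB[OF heptagon_shift[of m]]
    by (simp add: a_def b_def ac_simps)
  have iii: "b m \<or> b (m + 6) \<or> \<not> a m" for m
    using heptagon.condB_or_condB_or_not_condA[OF heptagon_shift[of m]]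
    by (simp add: a_def b_def ac_simps)
  have "\<exists>m. a (m + 6) \<and> b m"
  proof (rule ccontr)
    assume "\<not> ?thesis"
    then have no: "\<not> (a (m + 6) \<and> b m)" for m by blast
    \<comment> \<open>Failure of \<open>a m\<close> forces \<open>b (m + 5)\<close>, hence failure
      of \<open>a (m + 11)\<close>. Steps of 4 reach every residue modulo 7, so \<open>a\<close> is
      constant; both constant values are then refuted.\<close>
    have step: "\<not> a m \<Longrightarrow> \<not> a (m + 4)" for m
      using i[of m] no[of "m + 5"] per(1)[of "m + 4"] by (simp add: add.assoc)
    show False
    proof (cases "a 0 \<and> a 1 \<and> a 2 \<and> a 3 \<and> a 4 \<and> a 5 \<and> a 6")
      case True
      then show False
        using no[of 0] no[of 6] iii[of 0] w by simp
    next
      case False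
      then have "\<not> a 0 \<and> \<not> a 1 \<and> \<not> a 2 \<and> \<not> a 3 \<and> \<not> a 4 \<and> \<not> a 5 \<and> \<not> a 6"
        using step[of 0] step[of 1] step[of 2] step[of 3] step[of 4] step[of 5] step[of 6] w
        by simp blast
      then show False
        using i[of 2] ii[of 0] w by simp
    qed
  qed
  then show ?thesis by (simp add: a_def b_def ac_simps)
qed

text \<open>
  Up to the translations \<open>a s + v\<close>, \<open>b t - v\<close> and a scaling, the generators are forced by
  requiring seven of the nine sums to lie on the rays of \<open>p 0\<close>, ..., \<open>p 6\<close>; here \<open>v\<close> is chosen
  so that \<open>a 1 = 0\<close>. The hypotheses \<open>condA\<close> and \<open>condB\<close> put the other two sums \<open>z\<close>, \<open>w\<close>
  inside the cone.
\<close>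

lemma heptagon_generators:
  assumes A: "condA (\<lambda>i. p (i + 6))" and B: "condB p"
  obtains a b :: "nat \<Rightarrow> (real ^ 2) \<times> real" where
    "\<And>s t. s < 3 \<Longrightarrow> t < 3 \<Longrightarrow> a s + b t \<in> convex_cone hull (range p) - {0}"
    "\<And>i. \<exists>s t c. s < 3 \<and> t < 3 \<and> 0 < c \<and> a s + b t = c *\<^sub>R p i"
proof -
  \<comment> \<open>Coefficients of the linear relations among \<open>p 0\<close>, ...,
    \<open>p 3\<close> and among \<open>p 3\<close>, ..., \<open>p 6\<close>, normalised so that
    \<open>p 3\<close> has coefficient 1 in both.\<close>
  define x1 where "x1 = hdet (p 0) (p 2) (p 3) / hdet (p 0) (p 1) (p 2)"
  define x2 where "x2 = hdet (p 0) (p 1) (p 3) / hdet (p 0) (p 1) (p 2)"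
  define x0 where "x0 = hdet (p 1) (p 2) (p 3) / hdet (p 0) (p 1) (p 2)"
  define x4 where "x4 = hdet (p 3) (p 5) (p 6) / hdet (p 4) (p 5) (p 6)"
  define x5 where "x5 = hdet (p 3) (p 4) (p 6) / hdet (p 4) (p 5) (p 6)"
  define x6 where "x6 = hdet (p 3) (p 4) (p 5) / hdet (p 4) (p 5) (p 6)"
  have d: "0 < hdet (p 0) (p 1) (p 2)" "0 < hdet (p 4) (p 5) (p 6)"
    by (simp_all add: hdet_pos)
  have x: "0 < x0" "0 < x1" "0 < x2" "0 < x4" "0 < x5" "0 < x6"
    by (simp_all add: x0_def x1_def x2_def x4_def x5_def x6_def hdet_pos)
  have rel0: "x1 *\<^sub>R p 1 - x2 *\<^sub>R p 2 + p 3 = x0 *\<^sub>R p 0"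
  proof -
    have "hdet (p 0) (p 1) (p 2) *\<^sub>R (x1 *\<^sub>R p 1 - x2 *\<^sub>R p 2 + p 3) =
        hdet (p 0) (p 1) (p 2) *\<^sub>R (x0 *\<^sub>R p 0)"
      using hdet_cramer[of "p 1" "p 2" "p 3" "p 0"] d(1)
      by (simp add: x0_def x1_def x2_def scaleR_add_right scaleR_diff_right algebra_simps)
    then show ?thesis using d(1) by (metis less_irrefl scaleR_left_imp_eq)
  qed
  have rel6: "x5 *\<^sub>R p 5 - x4 *\<^sub>R p 4 + p 3 = x6 *\<^sub>R p 6"
  proof -
    have "hdet (p 4) (p 5) (p 6) *\<^sub>R (x5 *\<^sub>R p 5 - x4 *\<^sub>R p 4 + p 3) =
        hdet (p 4) (p 5) (p 6) *\<^sub>R (x6 *\<^sub>R p 6)"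
      using hdet_cramer[of "p 4" "p 5" "p 6" "p 3"] d(2)
      by (simp add: x6_def x5_def x4_def scaleR_add_right scaleR_diff_right algebra_simps)
    then show ?thesis using d(2) by (metis less_irrefl scaleR_left_imp_eq)
  qed
  define z where "z = x1 *\<^sub>R p 1 - x2 *\<^sub>R p 2 + x4 *\<^sub>R p 4"
  define w where "w = x5 *\<^sub>R p 5 - x4 *\<^sub>R p 4 + x2 *\<^sub>R p 2"
  \<comment> \<open>The several forms of \<open>z\<close> and \<open>w\<close> are for the edge
    inequalities: for most edges some form has only vanishing or nonnegative contributions.\<close>
  have z1: "z = x0 *\<^sub>R p 0 - p 3 + x4 *\<^sub>R p 4"
    unfolding z_def rel0[symmetric] by simp
  then have z2: "z = x0 *\<^sub>R p 0 - x6 *\<^sub>R p 6 + x5 *\<^sub>R p 5"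
    unfolding rel6[symmetric] by simp
  have w1: "w = x6 *\<^sub>R p 6 - p 3 + x2 *\<^sub>R p 2"
    unfolding w_def rel6[symmetric] by simp
  then have w2: "w = x6 *\<^sub>R p 6 - x0 *\<^sub>R p 0 + x1 *\<^sub>R p 1"
    unfolding rel0[symmetric] by simp
  have rot: "hdet (p j) (p k) (p i) = hdet (p i) (p j) (p k)"
    and rot': "hdet (p k) (p i) (p j) = hdet (p i) (p j) (p k)" for i j k
    using hdet_rotate by metis+
  have fan: "y \<in> convex_cone hull (range p)"
    if "0 \<le> hdet (p 0) (p 1) y" "0 \<le> hdet (p 1) (p 2) y" "0 \<le> hdet (p 2) (p 3) y"
      "0 \<le> hdet (p 3) (p 4) y" "0 \<le> hdet (p 4) (p 5) y" "0 \<le> hdet (p 5) (p 6) y"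
      "0 \<le> hdet (p 6) (p 0) y" for y
  proof -
    have "0 \<le> hdet (p i) (p (Suc i)) y" if "Suc i < 7" for i
    proof -
      have "i = 0 \<or> i = 1 \<or> i = 2 \<or> i = 3 \<or> i = 4 \<or> i = 5" using that by linarith
      then show ?thesis using \<open>0 \<le> hdet (p 0) (p 1) y\<close> \<open>0 \<le> hdet (p 1) (p 2) y\<close>
        \<open>0 \<le> hdet (p 2) (p 3) y\<close> \<open>0 \<le> hdet (p 3) (p 4) y\<close> \<open>0 \<le> hdet (p 4) (p 5) y\<close>
        \<open>0 \<le> hdet (p 5) (p 6) y\<close> by (auto simp: eval_nat_numeral)
    qed
    then show ?thesis
      unfolding range_eq using that(7)
      by (intro in_convex_cone_hull_fan) (simp_all add: hdet_pos)
  qed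
  note expand = hdet_add hdet_diff hdet_scaleR hdet_same
  \<comment> \<open>\<open>beta\<close> and \<open>beta'\<close> hold in every heptagon; only the
    edge \<open>p 4\<close>, \<open>p 5\<close> for \<open>z\<close> and the edge
    \<open>p 1\<close>, \<open>p 2\<close> for \<open>w\<close> need the hypotheses \<open>A\<close>
    and \<open>B\<close>.\<close>
  have beta: "hdet (p 0) (p 1) (p 3) * hdet (p 4) (p 5) (p 6) \<le>
      hdet (p 0) (p 1) (p 4) * hdet (p 3) (p 5) (p 6)"
    using hdet_lines_ratio[of "p 0" "p 1" "p 4" "p 3" "p 5" "p 6"]
      rot[of 5 6 0] rot'[of 5 3 4] rot'[of 5 0 4] rot[of 5 6 3] rot[of 5 6 4] rot'[of 5 0 3]
    by (simp add: hdet_pos less_imp_le)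
  have beta': "hdet (p 0) (p 1) (p 2) * hdet (p 3) (p 5) (p 6) \<le>
      hdet (p 0) (p 1) (p 3) * hdet (p 2) (p 5) (p 6)"
    using hdet_lines_ratio[of "p 0" "p 1" "p 3" "p 2" "p 5" "p 6"]
      rot[of 5 6 0] rot'[of 5 2 3] rot'[of 5 0 3] rot[of 5 6 2] rot[of 5 6 3] rot'[of 5 0 2]
    by (simp add: hdet_pos less_imp_le)
  have alpha: "hdet (p 0) (p 1) (p 3) * hdet (p 2) (p 4) (p 5) \<le>
      hdet (p 0) (p 2) (p 3) * hdet (p 1) (p 4) (p 5)"
    using A by (simp add: condA_def wrap)
  have z_in: "z \<in> convex_cone hull (range p)"
  proof (rule fan)
    show "0 \<le> hdet (p 0) (p 1) z"
      using beta d by (simp add: z_def expand x2_def x4_def field_simps)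
    show "0 \<le> hdet (p 1) (p 2) z" using x by (simp add: z_def expand hdet_pos less_imp_le)
    show "0 \<le> hdet (p 2) (p 3) z"
      using x rot[of 2 3 0] by (simp add: z1 expand hdet_pos less_imp_le)
    show "0 \<le> hdet (p 3) (p 4) z"
      using x rot[of 3 4 0] by (simp add: z1 expand hdet_pos less_imp_le)
    show "0 \<le> hdet (p 4) (p 5) z"
      using alpha d rot[of 4 5 1] rot[of 4 5 2]
      by (simp add: z_def expand x1_def x2_def field_simps)
    show "0 \<le> hdet (p 5) (p 6) z"
      using x rot[of 5 6 0] by (simp add: z2 expand hdet_pos less_imp_le)
    show "0 \<le> hdet (p 6) (p 0) z"
      using x rot'[of 6 0 5] by (simp add: z2 expand hdet_pos less_imp_le)
  qed
  have w_in: "w \<in> convex_cone hull (range p)"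
  proof (rule fan)
    show "0 \<le> hdet (p 0) (p 1) w" using x by (simp add: w2 expand hdet_pos less_imp_le)
    show "0 \<le> hdet (p 1) (p 2) w"
      using B d by (simp add: w_def expand x4_def x5_def condB_def field_simps)
    show "0 \<le> hdet (p 2) (p 3) w" using x by (simp add: w1 expand hdet_pos less_imp_le)
    show "0 \<le> hdet (p 3) (p 4) w"
      using x rot[of 3 4 2] by (simp add: w1 expand hdet_pos less_imp_le)
    show "0 \<le> hdet (p 4) (p 5) w"
      using x rot[of 4 5 2] by (simp add: w_def expand hdet_pos less_imp_le)
    show "0 \<le> hdet (p 5) (p 6) w"
      using beta' d rot[of 5 6 2] rot[of 5 6 4] by (simp add: w_def expand x2_def x4_def field_simps)
    show "0 \<le> hdet (p 6) (p 0) w"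
      using x rot'[of 6 0 1] by (simp add: w2 expand hdet_pos less_imp_le)
  qed
  \<comment> \<open>Excluding 0 is what later makes the height of every generator positive.\<close>
  have "0 < hdet (p 6) (p 0) z"
    using x rot'[of 6 0 5] by (simp add: z2 expand hdet_pos)
  then have "z \<noteq> 0" by (auto simp: hdet_0)
  have "0 < hdet (p 6) (p 0) w"
    using x rot'[of 6 0 1] by (simp add: w2 expand hdet_pos)
  then have "w \<noteq> 0" by (auto simp: hdet_0)
  have p_in: "c *\<^sub>R p i \<in> convex_cone hull (range p) - {0}" if "0 < c" for c i
  proof -
    have "0 < hdet (p (i + 1)) (p (i + 2)) (p i)"
      using hdet_pos[of i "i + 1" "i + 2"] by (simp add: hdet_rotate)
    then have "p i \<noteq> 0" by (auto simp: hdet_0)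
    then show ?thesis
      using that convex_cone_hull_mul[OF hull_inc[OF rangeI] less_imp_le[OF that]] by auto
  qed
  \<comment> \<open>In the 3 by 3 table of sums the rows lie on the rays of \<open>p 1\<close>,
    \<open>p 0\<close>, \<open>z\<close>; \<open>p 2\<close>, \<open>p 3\<close>,
    \<open>p 4\<close>; \<open>w\<close>, \<open>p 6\<close>, \<open>p 5\<close>.\<close>
  define a where "a s = (if s = 0 then x1 *\<^sub>R p 1 - x2 *\<^sub>R p 2 else if s = 1 then 0
    else x5 *\<^sub>R p 5 - x4 *\<^sub>R p 4)" for s :: nat
  define b where "b t = (if t = 0 then x2 *\<^sub>R p 2 else if t = 1 then p 3 else x4 *\<^sub>R p 4)" for t :: nat
  have ab: "a 0 + b 0 = x1 *\<^sub>R p 1" "a 0 + b 1 = x0 *\<^sub>R p 0" "a 0 + b 2 = z"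
    "a 1 + b 0 = x2 *\<^sub>R p 2" "a 1 + b 1 = 1 *\<^sub>R p 3" "a 1 + b 2 = x4 *\<^sub>R p 4"
    "a 2 + b 0 = w" "a 2 + b 1 = x6 *\<^sub>R p 6" "a 2 + b 2 = x5 *\<^sub>R p 5"
    by (simp_all add: a_def b_def z_def w_def rel0 rel6 del: One_nat_def)
  show ?thesis
  proof
    fix s t :: nat
    assume "s < 3" "t < 3"
    then have "s \<in> {0, 1, 2}" "t \<in> {0, 1, 2}" by auto
    moreover have "a 0 + b 0 \<in> convex_cone hull (range p) - {0}" "a 0 + b 1 \<in> convex_cone hull (range p) - {0}"
      "a 0 + b 2 \<in> convex_cone hull (range p) - {0}" "a 1 + b 0 \<in> convex_cone hull (range p) - {0}"
      "a 1 + b 1 \<in> convex_cone hull (range p) - {0}" "a 1 + b 2 \<in> convex_cone hull (range p) - {0}"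
      "a 2 + b 0 \<in> convex_cone hull (range p) - {0}" "a 2 + b 1 \<in> convex_cone hull (range p) - {0}"
      "a 2 + b 2 \<in> convex_cone hull (range p) - {0}"
      unfolding ab using p_in x z_in w_in \<open>z \<noteq> 0\<close> \<open>w \<noteq> 0\<close> zero_less_one by blast+
    ultimately show "a s + b t \<in> convex_cone hull (range p) - {0}"
      by (elim insertE emptyE) simp_all
  next
    fix i
    have "p i \<in> p ` {..<7}" using range_eq by blast
    then have "p i \<in> {p 0, p 1, p 2, p 3, p 4, p 5, p 6}"
      by (auto simp: eval_nat_numeral lessThan_Suc)
    then consider "p i = p 0" | "p i = p 1" | "p i = p 2" | "p i = p 3" | "p i = p 4" | "p i = p 5"
      | "p i = p 6" by blast
    then show "\<exists>s t c. s < 3 \<and> t < 3 \<and> 0 < c \<and> a s + b t = c *\<^sub>R p i"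
    proof cases
      case 1 show ?thesis unfolding 1 using ab(2) x by (intro exI[of _ 0] exI[of _ 1] exI[of _ x0]) auto
    next
      case 2 show ?thesis unfolding 2 using ab(1) x by (intro exI[of _ 0] exI[of _ 0] exI[of _ x1]) auto
    next
      case 3 show ?thesis unfolding 3 using ab(4) x by (intro exI[of _ 1] exI[of _ 0] exI[of _ x2]) auto
    next
      case 4 show ?thesis unfolding 4 using ab(5) by (intro exI[of _ 1] exI[of _ 1] exI[of _ 1]) auto
    next
      case 5 show ?thesis unfolding 5 using ab(6) x by (intro exI[of _ 1] exI[of _ 2] exI[of _ x4]) auto
    next
      case 6 show ?thesis unfolding 6 using ab(9) x by (intro exI[of _ 2] exI[of _ 2] exI[of _ x5]) auto
    next
      case 7 show ?thesis unfolding 7 using ab(8) x by (intro exI[of _ 2] exI[of _ 1] exI[of _ x6]) auto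
    qed
  qed
qed

end

section \<open>From heptagons to arbitrary polygons\<close>

text \<open>Reduction modulo 7 permutes an increasing triple within one period cyclically, and the
  determinant is invariant under cyclic permutations.\<close>

lemma heptagon_of_points:
  fixes v :: "nat \<Rightarrow> real ^ 2"
  assumes "\<And>i j k. i < j \<Longrightarrow> j < k \<Longrightarrow> k < 7 \<Longrightarrow> 0 < hdet (v i, 1) (v j, 1) (v k, 1)"
  shows "heptagon (\<lambda>i. (v (i mod 7), 1))"
proof
  fix i j k :: nat
  assume ijk: "i < j" "j < k" "k < i + 7"
  define r where "r = i mod 7"
  have i: "i = 7 * (i div 7) + r" and r: "r < 7" by (simp_all add: r_def)
  define s where "s = r + (j - i)"
  define t where "t = r + (k - i)"
  have rst: "r < s" "s < t" "t < r + 7" using ijk by (auto simp: s_def t_def)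
  have "j = 7 * (i div 7) + s" "k = 7 * (i div 7) + t"
    using ijk i by (simp_all add: s_def t_def)
  then have m: "j mod 7 = s mod 7" "k mod 7 = t mod 7" by simp_all
  consider "t < 7" | "s < 7" "7 \<le> t" | "7 \<le> s" by linarith
  then show "0 < hdet (v (i mod 7), 1) (v (j mod 7), 1) (v (k mod 7), 1)"
  proof cases
    case 1
    then show ?thesis unfolding m r_def[symmetric] using rst assms[of r s t] by simp
  next
    case 2
    then have "t mod 7 = t - 7" using rst r by (simp add: mod_if)
    then show ?thesis
      unfolding m r_def[symmetric] using rst 2 assms[of "t - 7" r s]
      by (simp add: hdet_rotate)
  next
    case 3
    then have "s mod 7 = s - 7" "t mod 7 = t - 7" using rst r by (simp_all add: mod_if)
    moreover have "s - 7 < t - 7" "t - 7 < r" using rst 3 by linarith+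
    ultimately show ?thesis
      unfolding m r_def[symmetric] using r assms[of "s - 7" "t - 7" r]
        hdet_rotate[of "(v (s - 7), 1)" "(v (t - 7), 1)" "(v r, 1)"]
      by simp
  qed
qed simp

lemma heptagon_points_generators:
  fixes V :: "(real ^ 2) set"
  assumes "card V = 7" "\<And>v. v \<in> V \<Longrightarrow> v \<notin> convex hull (V - {v})"
  obtains a b :: "nat \<Rightarrow> (real ^ 2) \<times> real" where
    "\<And>s t. s < 3 \<Longrightarrow> t < 3 \<Longrightarrow> 0 < snd (a s + b t) \<and> dehom (a s + b t) \<in> convex hull V"
    "\<And>v. v \<in> V \<Longrightarrow> \<exists>s t. s < 3 \<and> t < 3 \<and> v = dehom (a s + b t)"
proof -
  have fin: "finite V" using assms(1) card.infinite by fastforce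
  obtain v :: "nat \<Rightarrow> real ^ 2" where v: "v ` {..<7} = V"
    "\<And>i j k. i < j \<Longrightarrow> j < k \<Longrightarrow> k < 7 \<Longrightarrow> 0 < hdet (v i, 1) (v j, 1) (v k, 1)"
    using exists_convex_ordering[OF fin assms] by blast
  define p where "p i = (v (i mod 7), 1::real)" for i
  have "heptagon p"
    unfolding p_def using v(2) by (rule heptagon_of_points)
  then interpret heptagon p .
  obtain m where m: "condA (\<lambda>i. p (i + m + 6))" "condB (\<lambda>i. p (i + m))"
    using exists_good_labelling by blast
  interpret q: heptagon "\<lambda>i. p (i + m)" by (rule heptagon_shift)
  have m': "condA (\<lambda>i. p (i + 6 + m))" using m(1) by (simp add: ac_simps)
  obtain a b :: "nat \<Rightarrow> (real ^ 2) \<times> real" where ab: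
    "\<And>s t. s < 3 \<Longrightarrow> t < 3 \<Longrightarrow> a s + b t \<in> convex_cone hull (range (\<lambda>i. p (i + m))) - {0}"
    "\<And>i. \<exists>s t c. s < 3 \<and> t < 3 \<and> 0 < c \<and> a s + b t = c *\<^sub>R p (i + m)"
    using q.heptagon_generators[OF m' m(2)] by blast
  show ?thesis
  proof
    fix s t :: nat
    assume "s < 3" "t < 3"
    then have st: "a s + b t \<in> convex_cone hull (range (\<lambda>i. p (i + m)))" "a s + b t \<noteq> 0"
      using ab(1) by auto
    have "convex_cone hull (range (\<lambda>i. p (i + m))) \<subseteq> convex_cone hull (V \<times> {1})"
      using v(1) by (intro hull_mono) (auto simp: p_def)
    then have "a s + b t \<in> convex_cone hull (V \<times> {1})" using st(1) by blast
    \<comment> \<open>A nonzero element of the cone over \<open>V \<times> {1}\<close> is a positive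
      multiple of a point at height 1 over the hull.\<close>
    then obtain x c where xc: "x \<in> convex hull (V \<times> {1})" "0 \<le> c" "a s + b t = c *\<^sub>R x"
      using st(2) unfolding convex_cone_hull_convex_hull by auto
    have "c \<noteq> 0" using xc(3) st(2) by auto
    moreover have "fst x \<in> convex hull V" "snd x = 1"
      using xc(1) by (auto simp: convex_hull_Times)
    ultimately show "0 < snd (a s + b t) \<and> dehom (a s + b t) \<in> convex hull V"
      using xc by (simp add: dehom_def)
  next
    fix u assume "u \<in> V"
    then obtain i where i: "i < 7" "u = v i" using v(1) by auto
    obtain j where "p i = p (j + m)"
    proof -
      \<comment> \<open>The index \<open>i + 6 * m\<close> undoes the shift by \<open>m\<close>
        modulo 7.\<close>
      have "p i = p (i + 6 * m + m)" by (simp add: p_def mod_simps)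
      then show ?thesis by (rule that)
    qed
    moreover obtain s t c where "s < 3" "t < 3" "0 < c" "a s + b t = c *\<^sub>R p (j + m)"
      using ab(2) by blast
    ultimately show "\<exists>s t. s < 3 \<and> t < 3 \<and> u = dehom (a s + b t)"
      using i by (intro exI[of _ s] exI[of _ t]) (auto simp: dehom_def p_def)
  qed
qed

text \<open>Induction removes seven vertices at the cost of six inequalities, or a single one at the
  cost of one when fewer than seven remain. Any seven will do: subsets stay in convex position, and
  the extra generators lie in their hull.\<close>

lemma exists_cone_extension:
  fixes V :: "(real ^ 2) set"
  assumes "finite V" "\<And>v. v \<in> V \<Longrightarrow> v \<notin> convex hull (V - {v})"
  shows "\<exists>S. cone_extension (6 * (card V div 7) + card V mod 7) S \<and> (\<forall>s\<in>S. 0 < snd s) \<and>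
    dehom ` S \<subseteq> convex hull V \<and> V \<subseteq> dehom ` S"
  using assms
proof (induction "card V" arbitrary: V rule: less_induct)
  case less
  have sub: "u \<notin> convex hull (U - {u})" if "U \<subseteq> V" "u \<in> U" for U u
    using that less.prems(2)[of u] hull_mono[of "U - {u}" "V - {u}"] by blast
  consider "V = {}" | v where "v \<in> V" "card V < 7" | "7 \<le> card V" by fastforce
  then show ?case
  proof cases
    case 1
    then show ?thesis using cone_extension_empty by (intro exI[of _ "{}"]) auto
  next
    case 2
    define U where "U = V - {v}"
    have U: "card V = Suc (card U)" "finite U" "U \<subseteq> V" "V = insert v U"
      using 2(1) less.prems(1) card_Suc_Diff1[OF less.prems(1) 2(1)] by (auto simp: U_def)
    have less_card: "card U < card V" using U(1) by simp
    obtain S where S: "cone_extension (6 * (card U div 7) + card U mod 7) S" "\<forall>s\<in>S. 0 < snd s"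
      "dehom ` S \<subseteq> convex hull U" "U \<subseteq> dehom ` S"
      using less.hyps[OF less_card U(2) sub[OF U(3)]] by blast
    have "cone_extension (6 * (card V div 7) + card V mod 7) (insert (v, 1) S)"
      using cone_extension_insert[OF S(1)] 2(2) U(1) by simp
    moreover have "convex hull U \<subseteq> convex hull V" "v \<in> convex hull V"
      using U(3) 2(1) by (auto intro: hull_mono[THEN subsetD] hull_inc)
    ultimately show ?thesis
      using S U(4) by (intro exI[of _ "insert (v, 1) S"]) (auto simp: dehom_def)
  next
    case 3
    then obtain H where H: "H \<subseteq> V" "card H = 7"
      by (meson obtain_subset_with_card_n)
    define U where "U = V - H"
    have U: "card V = card U + 7" "finite U" "U \<subseteq> V" "V = H \<union> U"
      using H less.prems(1) 3 card_Diff_subset[OF finite_subset[OF H(1)], of V]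
      by (auto simp: U_def)
    have less_card: "card U < card V" using U(1) by simp
    obtain S where S: "cone_extension (6 * (card U div 7) + card U mod 7) S" "\<forall>s\<in>S. 0 < snd s"
      "dehom ` S \<subseteq> convex hull U" "U \<subseteq> dehom ` S"
      using less.hyps[OF less_card U(2) sub[OF U(3)]] by blast
    obtain a b :: "nat \<Rightarrow> (real ^ 2) \<times> real" where ab:
      "\<And>s t. s < 3 \<Longrightarrow> t < 3 \<Longrightarrow> 0 < snd (a s + b t) \<and> dehom (a s + b t) \<in> convex hull H"
      "\<And>v. v \<in> H \<Longrightarrow> \<exists>s t. s < 3 \<and> t < 3 \<and> v = dehom (a s + b t)"
      using heptagon_points_generators[OF H(2) sub[OF H(1)]] by blast
    define S' where "S' = S \<union> (\<lambda>(s, t). a s + b t) ` ({..<3} \<times> {..<3})"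
    have "6 * (card V div 7) + card V mod 7 = 6 * (card U div 7) + card U mod 7 + 6"
      using U(1) by simp
    then have "cone_extension (6 * (card V div 7) + card V mod 7) S'"
      using cone_extension_triangle_product[OF S(1), of a b] by (simp add: S'_def)
    moreover have "\<forall>s\<in>S'. 0 < snd s"
      using S(2) ab(1) by (auto simp: S'_def)
    moreover have "convex hull U \<subseteq> convex hull V" "convex hull H \<subseteq> convex hull V"
      using U(3) H(1) by (auto intro: hull_mono[THEN subsetD])
    then have "dehom ` S' \<subseteq> convex hull V"
      using S(3) ab(1) by (auto simp: S'_def)
    moreover have "V \<subseteq> dehom ` S'"
    proof
      fix u assume "u \<in> V"
      then consider "u \<in> U" | "u \<in> H" using U(4) by blast
      then show "u \<in> dehom ` S'"
      proof cases
        case 1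
        then show ?thesis using S(4) by (auto simp: S'_def)
      next
        case 2
        then obtain s t where "s < 3" "t < 3" "u = dehom (a s + b t)" using ab(2) by blast
        then show ?thesis by (force simp: S'_def)
      qed
    qed
    ultimately show ?thesis by blast
  qed
qed

theorem theorem3p4:
  fixes n :: nat and P :: "(real ^ 2) set"
  assumes "n \<ge> 3" and "convex_ngon n P"
  shows "extension_complexity P \<le> enat (nat \<lceil>6 * real n / 7\<rceil>)"
proof -
  define V where "V = {v. v extreme_point_of P}"
  have P: "polytope P" and card: "card V = n"
    using assms(2) by (auto simp: convex_ngon_def V_def)
  have fin: "finite V" using card assms(1) card.infinite by fastforce
  have PV: "P = convex hull V"
    unfolding V_def using P by (intro Krein_Milman_Minkowski polytope_imp_compact polytope_imp_convex)
  \<comment> \<open>A point in the hull of the others is redundant, but extreme points of a hull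
    belong to every generating set.\<close>
  have indep: "v \<notin> convex hull (V - {v})" if "v \<in> V" for v
  proof
    assume v: "v \<in> convex hull (V - {v})"
    have "convex hull V = convex hull (V - {v})"
      using v that by (metis hull_redundant insert_Diff)
    moreover have "v extreme_point_of P"
      using that by (simp add: V_def)
    ultimately have "v extreme_point_of convex hull (V - {v})"
      by (simp only: PV)
    then show False
      using extreme_point_of_convex_hull[of v "V - {v}"] by blast
  qed
  obtain S where S: "cone_extension (6 * (n div 7) + n mod 7) S" "\<forall>s\<in>S. 0 < snd s"
    "dehom ` S \<subseteq> convex hull V" "V \<subseteq> dehom ` S"
    using exists_cone_extension[OF fin indep] card by auto
  have "convex hull (dehom ` S) = P"
    unfolding PV using S(3,4) by (metis convex_convex_hull hull_minimal hull_mono subset_antisym)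
  then have "extension_complexity P \<le> enat (6 * (n div 7) + n mod 7)"
    using extension_complexity_le_cone_extension[OF S(1)] S(2) by auto
  \<comment> \<open>With \<open>r = n mod 7\<close> the claim reduces to
    \<open>r - 1 < 6 * r / 7\<close>, which is \<open>r < 7\<close>; the ceiling absorbs the
    gap.\<close>
  also have "6 * (n div 7) + n mod 7 \<le> nat \<lceil>6 * real n / 7\<rceil>"
  proof -
    have "real n = 7 * real (n div 7) + real (n mod 7)"
      by (metis mult_div_mod_eq of_nat_add of_nat_mult of_nat_numeral)
    moreover have "real (n mod 7) < 7" by simp
    ultimately have "real (6 * (n div 7) + n mod 7) - 1 < 6 * real n / 7" by simp
    then have "int (6 * (n div 7) + n mod 7) \<le> \<lceil>6 * real n / 7\<rceil>"
      by linarith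
    then show ?thesis by linarith
  qed
  finally show ?thesis by simp
qed

end
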